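(* Let $N\ge2$, let $\lambda,\mu,\kappa,\eta,C>0$ and $\rho=\lambda/\mu$ with $\rho<C$. Consider the $2N$-dimensional linear stochastic differential equation $$d\vec Y_t=-P\vec Y_t\,dt+D\,d\vec B_t,\qquad P=\begin{pmatrix}A&B\\0&E\end{pmatrix},$$ where $\vec B$ is a standard $2N$-dimensional Brownian motion and $A,B,E$ are the $N\times N$ matrices with $$A_{ii}=\mu\frac{C-\rho}{\kappa/\eta}\Bigl(1-\frac{\rho}{NC}\Bigr),\qquad A_{ij}=-\mu\frac{\rho(C-\rho)}{NC\,\kappa/\eta}\ (i\ne j),\qquad B_{ij}=-\mu\frac{\rho(C-\rho)}{NC\,\kappa/\eta}\ (\text{all }i,j),\qquad E=\eta\,\mathrm{Id},$$ and $D$ is the diagonal matrix with $D_{ii}=\sqrt{2\lambda}$ for $i=1,\dots,N$ and $D_{ii}=\sqrt{2\kappa}$ for $i=N+1,\dots,2N$. (This is the diffusion limit around the equilibrium point for the purely symmetric circle network with integrated streaming and elastic traffic.) As $t\to\infty$, $\vec Y_t$ converges in distribution to a multivariate normal distribution with mean zero; writing $(n_1,\dots,n_N,m_1,\dots,m_N)$ for a vector with this limiting distribution, its covariances are, for $i\ne j$, $$\mathrm{Cov}(n_i,n_j)=\frac1N\frac{\kappa}{\eta}\left(\frac{\rho^2}{(C-\rho)^2}+\frac{\lambda\rho}{\mu(C-\rho)^2+C\kappa}\right),\qquad \mathrm{Var}(n_i)=\frac{\kappa}{\eta}\frac{\rho}{C-\rho}+\mathrm{Cov}(n_i,n_j),$$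 $$\mathrm{Cov}(m_i,m_j)=0,\qquad \mathrm{Var}(m_i)=\frac{\kappa}{\eta},$$ and, for all $i,j$ (including $i=j$), $$\mathrm{Cov}(n_i,m_j)=\frac1N\frac{\kappa}{\eta}\frac{\lambda(C-\rho)}{\mu(C-\rho)^2+C\kappa}.$$
   Context: $\mathrm{Id}$ is the $N\times N$ identity matrix. The first $N$ coordinates correspond to (centred, rescaled) numbers of elastic flows and the last $N$ to streaming flows. Background: in the purely symmetric circle network there are $N$ resources of capacity $C$ and $N$ flow types, type $i$ being able to use resources $i,i+1,\dots,i+r-1$ (mod $N$), $r\ge2$; elastic flows of each type arrive at rate $\lambda$ with mean size $1/\mu$, streaming flows at rate $\kappa$ with mean duration $1/\eta$; the equilibrium point of the fluid limit is $\hat m=\kappa/\eta$, $\hat n=\rho\hat m/(C-\rho)$ for each type. *)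

theory Defs
  imports "HOL-Probability.Probability"
begin

section \<open>Normal laws, covariance, weak convergence\<close>

text \<open>\<open>\<sigma>\<close> is the standard deviation; \<open>\<sigma> = 0\<close> gives the point mass at \<open>m\<close>.\<close>

definition normal_law :: "real \<Rightarrow> real \<Rightarrow> real measure" where
  "normal_law m \<sigma> =
     (if \<sigma> = 0 then return borel m else density lborel (\<lambda>x. ennreal (normal_density m \<sigma> x)))"

text \<open>A law on a Euclidean space is multivariate normal iff every linear functional of it has a
  one-dimensional, possibly degenerate, normal law.\<close>

definition multivariate_normal :: "'v::euclidean_space measure \<Rightarrow> bool" where
  "multivariate_normal L \<longleftrightarrow>
     prob_space L \<and> sets L = sets borel \<and>
     (\<forall>u. \<exists>m \<sigma>. 0 \<le> \<sigma> \<and> distr L borel (\<lambda>x. u \<bullet> x) = normal_law m \<sigma>)"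

definition covariance :: "'w measure \<Rightarrow> ('w \<Rightarrow> real) \<Rightarrow> ('w \<Rightarrow> real) \<Rightarrow> real" where
  "covariance M X Y =
     (\<integral>\<omega>. (X \<omega> - (\<integral>\<omega>'. X \<omega>' \<partial>M)) * (Y \<omega> - (\<integral>\<omega>'. Y \<omega>' \<partial>M)) \<partial>M)"

text \<open>The library's \<^const>\<open>weak_conv_m\<close> is restricted to sequences of laws on the real line.\<close>

definition converges_in_distribution ::
  "'w measure \<Rightarrow> ('t \<Rightarrow> 'w \<Rightarrow> 'v::euclidean_space) \<Rightarrow> 'v measure \<Rightarrow> 't filter \<Rightarrow> bool" where
  "converges_in_distribution M Y L G \<longleftrightarrow>
     (\<forall>f :: 'v \<Rightarrow> real. continuous_on UNIV f \<and> bounded (range f) \<longrightarrow>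
        ((\<lambda>t. \<integral>x. f x \<partial>(distr M borel (Y t))) \<longlongrightarrow> (\<integral>x. f x \<partial>L)) G)"

section \<open>Brownian motion and linear equations with additive noise\<close>

text \<open>Time is \<open>[0, \<infinity>)\<close>: processes and filtrations are indexed by \<^typ>\<open>real\<close>, but only their
  values at nonnegative times are constrained or used.\<close>

definition filtration_on :: "'w measure \<Rightarrow> (real \<Rightarrow> 'w measure) \<Rightarrow> bool" where
  "filtration_on M F \<longleftrightarrow>
     (\<forall>t\<ge>0. subalgebra M (F t)) \<and> (\<forall>s t. 0 \<le> s \<and> s \<le> t \<longrightarrow> subalgebra (F t) (F s))"

definition adapted_process ::
  "(real \<Rightarrow> 'w measure) \<Rightarrow> (real \<Rightarrow> 'w \<Rightarrow> 'v::topological_space) \<Rightarrow> bool" where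
  "adapted_process F X \<longleftrightarrow> (\<forall>t\<ge>0. X t \<in> borel_measurable (F t))"

definition standard_brownian_motion ::
  "'w measure \<Rightarrow> (real \<Rightarrow> 'w measure) \<Rightarrow> (real \<Rightarrow> 'w \<Rightarrow> real ^ 'd::finite) \<Rightarrow> bool" where
  "standard_brownian_motion M F W \<longleftrightarrow>
     adapted_process F W \<and>
     (AE \<omega> in M. W 0 \<omega> = 0) \<and>
     (AE \<omega> in M. continuous_on {0..} (\<lambda>t. W t \<omega>)) \<and>
     (\<forall>s t. 0 \<le> s \<and> s < t \<longrightarrow>
        prob_space.indep_set M (sets (F s))
          (sets (vimage_algebra (space M) (\<lambda>\<omega>. W t \<omega> - W s \<omega>) borel)) \<and>
        prob_space.indep_vars M (\<lambda>_. borel) (\<lambda>i \<omega>. (W t \<omega> - W s \<omega>) $ i) UNIV \<and>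
        (\<forall>i. distributed M lborel (\<lambda>\<omega>. (W t \<omega> - W s \<omega>) $ i)
               (\<lambda>x. ennreal (normal_density 0 (sqrt (t - s)) x))))"

text \<open>Solutions of \<open>dY = - P Y dt + D dW\<close>. As \<open>D\<close> is constant, the stochastic integral of \<open>D\<close>
  against \<open>W\<close> is \<open>D (W t - W 0)\<close>. The initial value \<open>Y 0\<close> may be any random variable measurable
  at time 0.\<close>

definition solves_linear_sde ::
  "'w measure \<Rightarrow> (real \<Rightarrow> 'w measure) \<Rightarrow> real ^ 'd ^ 'd \<Rightarrow> real ^ 'd ^ 'd \<Rightarrow>
     (real \<Rightarrow> 'w \<Rightarrow> real ^ 'd::finite) \<Rightarrow> (real \<Rightarrow> 'w \<Rightarrow> real ^ 'd) \<Rightarrow> bool" where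
  "solves_linear_sde M F P D W Y \<longleftrightarrow>
     adapted_process F Y \<and>
     (AE \<omega> in M. continuous_on {0..} (\<lambda>t. Y t \<omega>)) \<and>
     (AE \<omega> in M. \<forall>t\<ge>0.
        Y t \<omega> = Y 0 \<omega> - integral {0..t} (\<lambda>s. P *v Y s \<omega>) + D *v (W t \<omega> - W 0 \<omega>))"

section \<open>The coefficients for the symmetric circle network\<close>

text \<open>\<open>N = CARD('n)\<close>. Vectors of length \<open>2N\<close> are indexed by \<open>'n + 'n\<close>: \<^const>\<open>Inl\<close> for the first
  \<open>N\<close> coordinates (elastic flows), \<^const>\<open>Inr\<close> for the last \<open>N\<close> (streaming flows).\<close>

definition A_mat :: "real \<Rightarrow> real \<Rightarrow> real \<Rightarrow> real \<Rightarrow> real \<Rightarrow> real ^ 'n ^ 'n::finite" where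
  "A_mat \<mu> \<kappa> \<eta> C \<rho> = (\<chi> i j.
     if i = j then \<mu> * ((C - \<rho>) / (\<kappa> / \<eta>)) * (1 - \<rho> / (real CARD('n) * C))
     else - \<mu> * (\<rho> * (C - \<rho>) / (real CARD('n) * C * (\<kappa> / \<eta>))))"

definition B_mat :: "real \<Rightarrow> real \<Rightarrow> real \<Rightarrow> real \<Rightarrow> real \<Rightarrow> real ^ 'n ^ 'n::finite" where
  "B_mat \<mu> \<kappa> \<eta> C \<rho> = (\<chi> i j.
     - \<mu> * (\<rho> * (C - \<rho>) / (real CARD('n) * C * (\<kappa> / \<eta>))))"

definition E_mat :: "real \<Rightarrow> real ^ 'n ^ 'n::finite" where
  "E_mat \<eta> = \<eta> *\<^sub>R mat 1"

definition P_mat :: "real \<Rightarrow> real \<Rightarrow> real \<Rightarrow> real \<Rightarrow> real \<Rightarrow> real ^ ('n + 'n) ^ ('n::finite + 'n)" where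
  "P_mat \<mu> \<kappa> \<eta> C \<rho> = (\<chi> k l.
     case k of
       Inl i \<Rightarrow> (case l of Inl j \<Rightarrow> A_mat \<mu> \<kappa> \<eta> C \<rho> $ i $ j | Inr j \<Rightarrow> B_mat \<mu> \<kappa> \<eta> C \<rho> $ i $ j)
     | Inr i \<Rightarrow> (case l of Inl j \<Rightarrow> 0 | Inr j \<Rightarrow> E_mat \<eta> $ i $ j))"

definition D_mat :: "real \<Rightarrow> real \<Rightarrow> real ^ ('n + 'n) ^ ('n::finite + 'n)" where
  "D_mat lam \<kappa> = (\<chi> k l.
     if k = l then (case k of Inl _ \<Rightarrow> sqrt (2 * lam) | Inr _ \<Rightarrow> sqrt (2 * \<kappa>)) else 0)"

end

theory Submission
  imports Defs
begin

text \<open>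
  If \<open>v\<close> solves the adjoint equation \<open>v' = - P\<^sup>T v\<close>, \<open>v 0 = u\<close>, then pathwise integration by parts shows
  that \<open>u \<bullet> Y t - v t \<bullet> Y 0\<close> is a limit of sums \<open>\<Sum> D\<^sup>T v (t - t\<^sub>k) \<bullet> (W t\<^sub>k\<^sub>+\<^sub>1 - W t\<^sub>k)\<close>, hence centred normal
  with variance \<open>\<integral>\<^sub>0\<^sup>t \<bar>D\<^sup>T v\<bar>\<^sup>2\<close>, and no stochastic integral is needed. If \<open>P S + S P\<^sup>T = D D\<^sup>T\<close>, the integrand
  is \<open>- (v \<bullet> S v)'\<close>, so the variance is \<open>u \<bullet> S u - v t \<bullet> S v t\<close>, which tends to \<open>u \<bullet> S u\<close> since \<open>v\<close> decays.
  The characteristic functions of \<open>Y t\<close> therefore converge to that of the normal law with covariance \<open>S\<close>.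

  Weak convergence in several dimensions is reduced to Levy's theorem on the real line: applied to
  tilted laws it shows that the test functions \<open>f\<close> for which all \<open>\<integral> f x cos (u \<bullet> x + a)\<close> converge are
  closed under multiplication by \<open>\<psi> (e \<bullet> x)\<close>, and Stone-Weierstrass does the rest.

  For the circle network all blocks are of the form \<open>x I + y J\<close> with \<open>J\<close> the all-ones matrix, so the
  Lyapunov equation becomes a few scalar identities.
\<close>

section \<open>Weak convergence from characteristic functions\<close>

text \<open>Phases 0 and \<open>-pi/2\<close> give the real and imaginary parts of
  \<open>exp (i (u \<bullet> x))\<close>, so the condition says that the Fourier transforms of the
  signed measures with density f converge pointwise. Keeping all frequencies u in the definition
  makes it stable under multiplication by cosines.\<close>

definition ridge_convergent ::
  "(nat \<Rightarrow> 'v::euclidean_space measure) \<Rightarrow> 'v measure \<Rightarrow> ('v \<Rightarrow> real) \<Rightarrow> bool" where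
  "ridge_convergent \<mu> L f \<longleftrightarrow> continuous_on UNIV f \<and> bounded (range f) \<and>
     (\<forall>u a. (\<lambda>n. \<integral>x. f x * cos (u \<bullet> x + a) \<partial>\<mu> n) \<longlonglongrightarrow> (\<integral>x. f x * cos (u \<bullet> x + a) \<partial>L))"

lemma integrable_bounded_continuous:
  fixes f :: "'v::euclidean_space \<Rightarrow> real"
  assumes "prob_space \<mu>" "sets \<mu> = sets borel" "continuous_on UNIV f" "bounded (range f)"
  shows "integrable \<mu> f"
proof -
  interpret prob_space \<mu> by fact
  obtain B where "\<And>x. norm (f x) \<le> B"
    using assms(4) by (auto simp: bounded_iff)
  moreover have "f \<in> borel_measurable \<mu>"
    using borel_measurable_continuous_onI[OF assms(3)] measurable_cong_sets[OF assms(2) refl] by blast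
  ultimately show ?thesis
    by (intro integrable_const_bound[where B=B]) auto
qed

lemma bounded_range_mult:
  fixes f g :: "'a \<Rightarrow> real"
  assumes "bounded (range f)" "bounded (range g)"
  shows "bounded (range (\<lambda>x. f x * g x))"
proof -
  obtain A B where "\<And>x. norm (f x) \<le> A" "\<And>x. norm (g x) \<le> B"
    using assms by (auto simp: bounded_iff)
  then have "norm (f x * g x) \<le> A * B" for x
    unfolding norm_mult using order_trans[OF norm_ge_zero] by (intro mult_mono) blast+
  then show ?thesis by (auto simp: bounded_iff)
qed

lemma bounded_range_cos: "bounded (range (\<lambda>x. cos (g x) :: real))"
  by (auto simp: bounded_iff intro: exI[of _ 1])

lemma bounded_range_const: "bounded (range (\<lambda>x. c :: real))"
  by (auto simp: bounded_iff)

section \<open>Levy's theorem for tilted laws projected to a line\<close>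

locale levy_setting =
  fixes \<mu> :: "nat \<Rightarrow> 'v::euclidean_space measure" and L :: "'v measure"
  assumes prob_mu: "\<And>n. prob_space (\<mu> n)" and sets_mu: "\<And>n. sets (\<mu> n) = sets borel"
    and prob_L: "prob_space L" and sets_L: "sets L = sets borel"
begin

lemmas integrable_bc = integrable_bounded_continuous[OF prob_mu sets_mu]
  integrable_bounded_continuous[OF prob_L sets_L]

text \<open>Dividing by the total mass m, which is at least 1 because g is, makes the weighted law a
  probability, so that one-dimensional results apply to its image on the line. The test function
  takes Banach space values since it serves for real functions as well as for complex
  exponentials.\<close>

lemma integral_density_projection:
  fixes g :: "'v \<Rightarrow> real" and \<psi> :: "real \<Rightarrow> 'b::{banach, second_countable_topology}"
  assumes \<nu>: "prob_space \<nu>" "sets \<nu> = sets borel"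
    and g: "continuous_on UNIV g" "bounded (range g)" "\<And>x. 1 \<le> g x"
    and m: "m = (\<integral>x. g x \<partial>\<nu>)" and \<psi>: "\<psi> \<in> borel_measurable borel"
  shows "real_distribution (distr (density \<nu> (\<lambda>x. ennreal (g x / m))) borel (\<lambda>x. e \<bullet> x))"
    and "1 \<le> m"
    and "integral\<^sup>L (distr (density \<nu> (\<lambda>x. ennreal (g x / m))) borel (\<lambda>x. e \<bullet> x)) \<psi> =
           (\<integral>x. g x *\<^sub>R \<psi> (e \<bullet> x) \<partial>\<nu>) /\<^sub>R m"
proof -
  interpret prob_space \<nu> by fact
  note [measurable_cong] = \<nu>(2)
  have [measurable]: "g \<in> borel_measurable borel"
    by (rule borel_measurable_continuous_onI[OF g(1)])
  note [measurable] = \<psi>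
  have int: "integrable \<nu> g" by (rule integrable_bounded_continuous) fact+
  have "(\<integral>x. 1 \<partial>\<nu>) \<le> (\<integral>x. g x \<partial>\<nu>)"
    using int g(3) by (intro integral_mono) auto
  then show m1: "1 \<le> m" by (simp add: m prob_space)
  have nn: "0 \<le> g x / m" for x using g(3)[of x] m1 by simp
  let ?d = "density \<nu> (\<lambda>x. ennreal (g x / m))"
  have "emeasure ?d (space ?d) = (\<integral>\<^sup>+x. ennreal (g x / m) \<partial>\<nu>)"
    by (subst emeasure_density) (auto intro!: nn_integral_cong)
  also have "\<dots> = ennreal (\<integral>x. g x / m \<partial>\<nu>)"
    using int nn by (intro nn_integral_eq_integral) auto
  also have "(\<integral>x. g x / m \<partial>\<nu>) = 1"
    using m1 by (simp add: m)
  finally have "prob_space ?d" by (auto intro: prob_spaceI)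
  then have "prob_space (distr ?d borel (\<lambda>x. e \<bullet> x))"
    by (rule prob_space.prob_space_distr) measurable
  then show "real_distribution (distr ?d borel (\<lambda>x. e \<bullet> x))"
    by (simp add: real_distribution_def real_distribution_axioms_def)
  have "integral\<^sup>L (distr ?d borel (\<lambda>x. e \<bullet> x)) \<psi> = (\<integral>x. \<psi> (e \<bullet> x) \<partial>?d)"
    by (rule integral_distr) measurable
  also have "\<dots> = (\<integral>x. (g x / m) *\<^sub>R \<psi> (e \<bullet> x) \<partial>\<nu>)"
    using nn by (intro integral_density) auto
  also have "\<dots> = (\<integral>x. (g x *\<^sub>R \<psi> (e \<bullet> x)) /\<^sub>R m \<partial>\<nu>)"
    by (simp add: field_simps scaleR_conv_of_real)
  also have "\<dots> = (\<integral>x. g x *\<^sub>R \<psi> (e \<bullet> x) \<partial>\<nu>) /\<^sub>R m"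
    by (rule integral_scaleR_right)
  finally show "integral\<^sup>L (distr ?d borel (\<lambda>x. e \<bullet> x)) \<psi> = (\<integral>x. g x *\<^sub>R \<psi> (e \<bullet> x) \<partial>\<nu>) /\<^sub>R m" .
qed

text \<open>The cosine hypothesis contains the characteristic functions of the normalised tilted
  projections. Levy's continuity theorem on the line then yields weak convergence, and multiplying
  by the convergent masses undoes the normalisation.\<close>

lemma tilted_projection_limit:
  fixes \<psi> :: "real \<Rightarrow> real"
  assumes g: "continuous_on UNIV g" "bounded (range g)" "\<And>x. 1 \<le> g x"
    and conv: "\<And>\<theta> a. (\<lambda>n. \<integral>x. g x * cos (\<theta> * (e \<bullet> x) + a) \<partial>\<mu> n)
                 \<longlonglongrightarrow> (\<integral>x. g x * cos (\<theta> * (e \<bullet> x) + a) \<partial>L)"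
    and \<psi>: "continuous_on UNIV \<psi>" "bounded (range \<psi>)"
  shows "(\<lambda>n. \<integral>x. g x * \<psi> (e \<bullet> x) \<partial>\<mu> n) \<longlonglongrightarrow> (\<integral>x. g x * \<psi> (e \<bullet> x) \<partial>L)"
proof -
  define I where "I \<nu> = (\<integral>x. g x \<partial>\<nu>)" for \<nu> :: "'v measure"
  define T where "T \<nu> = distr (density \<nu> (\<lambda>x. ennreal (g x / I \<nu>))) borel (\<lambda>x. e \<bullet> x)"
    for \<nu> :: "'v measure"
  note fact_mu = integral_density_projection(1)[where e=e, OF prob_mu sets_mu g I_def, folded T_def]
    integral_density_projection(2)[OF prob_mu sets_mu g I_def]
    integral_density_projection(3)[where e=e, OF prob_mu sets_mu g I_def, folded T_def]
  note fact_L = integral_density_projection(1)[where e=e, OF prob_L sets_L g I_def, folded T_def]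
    integral_density_projection(2)[OF prob_L sets_L g I_def]
    integral_density_projection(3)[where e=e, OF prob_L sets_L g I_def, folded T_def]
  have [measurable]: "\<psi> \<in> borel_measurable borel"
    by (rule borel_measurable_continuous_onI[OF \<psi>(1)])
  \<comment> \<open>Frequency and phase zero reduce the cosine to 1.\<close>
  have mass: "(\<lambda>n. I (\<mu> n)) \<longlonglongrightarrow> I L"
    using conv[of 0 0] by (simp add: I_def)
  \<comment> \<open>The imaginary part appears as a cosine with phase \<open>-pi/2\<close>, so both
    parts have the form covered by \<open>conv\<close>.\<close>
  have charT: "char (T \<nu>) \<theta> = complex_of_real (\<integral>x. g x * cos (\<theta> * (e \<bullet> x) + 0) \<partial>\<nu>) / I \<nu>
      + \<i> * (complex_of_real (\<integral>x. g x * cos (\<theta> * (e \<bullet> x) + (-pi/2)) \<partial>\<nu>) / I \<nu>)"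
    if \<nu>: "prob_space \<nu>" "sets \<nu> = sets borel" for \<nu> \<theta>
  proof -
    interpret prob_space \<nu> by fact
    have c: "continuous_on UNIV (\<lambda>x. g x * cos (\<theta> * (e \<bullet> x) + a))" for a
      by (intro continuous_intros g)
    have int: "integrable \<nu> (\<lambda>x. g x * cos (\<theta> * (e \<bullet> x) + a))" for a
      by (rule integrable_bounded_continuous[OF \<nu> c])
         (intro bounded_range_mult g bounded_range_cos)
    have "char (T \<nu>) \<theta> = (\<integral>x. g x *\<^sub>R iexp (\<theta> * (e \<bullet> x)) \<partial>\<nu>) /\<^sub>R I \<nu>"
      unfolding char_def using integral_density_projection(3)[OF \<nu> g I_def, of "\<lambda>x. iexp (\<theta> * x)" e, folded T_def]
      by simp
    also have "(\<integral>x. g x *\<^sub>R iexp (\<theta> * (e \<bullet> x)) \<partial>\<nu>) =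
      (\<integral>x. complex_of_real (g x * cos (\<theta> * (e \<bullet> x) + 0)) + \<i> * complex_of_real (g x * cos (\<theta> * (e \<bullet> x) + (-pi/2))) \<partial>\<nu>)"
      by (intro Bochner_Integration.integral_cong refl)
         (auto simp: complex_eq_iff Re_exp Im_exp cos_diff)
    also have "\<dots> = complex_of_real (\<integral>x. g x * cos (\<theta> * (e \<bullet> x) + 0) \<partial>\<nu>)
        + \<i> * complex_of_real (\<integral>x. g x * cos (\<theta> * (e \<bullet> x) + (-pi/2)) \<partial>\<nu>)"
      using int[of 0] int[of "-pi/2"] by (subst Bochner_Integration.integral_add)
        (auto intro!: integrable_of_real integrable_mult_right simp del: of_real_mult simp: integral_complex_of_real)
    finally show ?thesis by (simp only: scaleR_conv_of_real divide_inverse of_real_inverse) (simp only: algebra_simps)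
  qed
  have "weak_conv_m (\<lambda>n. T (\<mu> n)) (T L)"
  proof (rule levy_continuity)
    show "real_distribution (T (\<mu> n))" "real_distribution (T L)" for n
      using fact_mu(1)[of \<psi>] fact_L(1)[of \<psi>] by simp_all
    have "I L \<noteq> 0" using fact_L(2)[of \<psi>] by force
    then show "(\<lambda>n. char (T (\<mu> n)) \<theta>) \<longlonglongrightarrow> char (T L) \<theta>" for \<theta>
      unfolding charT[OF prob_mu sets_mu] charT[OF prob_L sets_L]
      by (intro tendsto_intros mass conv) auto
  qed
  moreover obtain B where "\<And>x. norm (\<psi> x) \<le> B" using \<psi>(2) by (auto simp: bounded_iff)
  moreover have "isCont \<psi> x" for x using \<psi>(1) by (simp add: continuous_on_eq_continuous_at)
  ultimately have "(\<lambda>n. integral\<^sup>L (T (\<mu> n)) \<psi>) \<longlonglongrightarrow> integral\<^sup>L (T L) \<psi>"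
    using fact_mu(1)[of \<psi>] fact_L(1)[of \<psi>]
    by (intro weak_conv_imp_integral_bdd_continuous_conv[where B=B]) auto
  then have "(\<lambda>n. I (\<mu> n) * integral\<^sup>L (T (\<mu> n)) \<psi>) \<longlonglongrightarrow> I L * integral\<^sup>L (T L) \<psi>"
    by (intro tendsto_mult mass)
  moreover have "I L \<noteq> 0" "I (\<mu> n) \<noteq> 0" for n using fact_L(2)[of \<psi>] fact_mu(2)[of \<psi> n] by force+
  ultimately show ?thesis
    by (simp add: fact_L(3)[of \<psi>] fact_mu(3)[of \<psi>] mult.assoc[symmetric])
qed

section \<open>Closure properties of ridge convergence\<close>

lemma ridge_convergent_add:
  assumes f: "ridge_convergent \<mu> L f" and g: "ridge_convergent \<mu> L g"
  shows "ridge_convergent \<mu> L (\<lambda>x. f x + g x)"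
proof -
  have c: "continuous_on UNIV (\<lambda>x. h x * cos (u \<bullet> x + a))" "bounded (range (\<lambda>x. h x * cos (u \<bullet> x + a)))"
    if "ridge_convergent \<mu> L h" for h u a
    using that by (auto simp: ridge_convergent_def intro!: continuous_intros bounded_range_mult bounded_range_cos)
  show ?thesis
    unfolding ridge_convergent_def
  proof (intro conjI allI)
    show "continuous_on UNIV (\<lambda>x. f x + g x)" "bounded (range (\<lambda>x. f x + g x))"
      using f g by (auto simp: ridge_convergent_def intro!: continuous_intros bounded_plus_comp)
    show "(\<lambda>n. \<integral>x. (f x + g x) * cos (u \<bullet> x + a) \<partial>\<mu> n) \<longlonglongrightarrow> (\<integral>x. (f x + g x) * cos (u \<bullet> x + a) \<partial>L)" for u a
      using f g by (simp add: distrib_right integrable_bc[OF c[OF f]] integrable_bc[OF c[OF g]] ridge_convergent_def tendsto_add)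
  qed
qed

lemma ridge_convergent_cmult:
  assumes "ridge_convergent \<mu> L f"
  shows "ridge_convergent \<mu> L (\<lambda>x. f x * c)"
proof -
  have *: "f x * c * cos y = c * (f x * cos y)" for x y by simp
  show ?thesis
    using assms unfolding ridge_convergent_def *
    by (auto intro!: continuous_intros tendsto_intros bounded_range_mult bounded_range_const)
qed

text \<open>The product-to-sum formula turns two cosines into cosines of frequencies
  \<open>w + u\<close> and \<open>w - u\<close>, for which convergence is already part of the
  hypothesis.\<close>

lemma ridge_convergent_mult_cos:
  assumes "ridge_convergent \<mu> L f"
  shows "ridge_convergent \<mu> L (\<lambda>x. f x * cos (w \<bullet> x + b))"
proof -
  have eq: "f x * cos (w \<bullet> x + b) * cos (u \<bullet> x + a) =
      (f x * cos ((w + u) \<bullet> x + (b + a)) + f x * cos ((w - u) \<bullet> x + (b - a))) / 2" for x u a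
    using cos_times_cos[of "w \<bullet> x + b" "u \<bullet> x + a"]
    by (simp add: algebra_simps inner_simps)
  have c: "continuous_on UNIV (\<lambda>x. f x * cos (u \<bullet> x + a))" "bounded (range (\<lambda>x. f x * cos (u \<bullet> x + a)))" for u a
    using assms by (auto simp: ridge_convergent_def intro!: continuous_intros bounded_range_mult bounded_range_cos)
  show ?thesis
    unfolding ridge_convergent_def
  proof (intro conjI allI)
    show "(\<lambda>n. \<integral>x. f x * cos (w \<bullet> x + b) * cos (u \<bullet> x + a) \<partial>\<mu> n)
        \<longlonglongrightarrow> (\<integral>x. f x * cos (w \<bullet> x + b) * cos (u \<bullet> x + a) \<partial>L)" for u a
      using assms by (simp add: eq integrable_bc[OF c] ridge_convergent_def tendsto_intros)
  qed (fact c)+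
qed

text \<open>For \<open>f \<ge> 1\<close>, Levy's one-dimensional theorem applies to the images under \<open>x \<mapsto> e \<bullet> x\<close> of the laws
  weighted by \<open>f\<close>; a constant shift reduces the general case to this one.\<close>

lemma ridge_convergent_mult_ridge:
  assumes f: "ridge_convergent \<mu> L f" and one: "ridge_convergent \<mu> L (\<lambda>_. 1)"
    and \<psi>: "continuous_on UNIV \<psi>" "bounded (range \<psi>)"
  shows "ridge_convergent \<mu> L (\<lambda>x. f x * \<psi> (e \<bullet> x))"
proof -
  have pos: "(\<lambda>n. \<integral>x. g x * \<psi> (e \<bullet> x) \<partial>\<mu> n) \<longlonglongrightarrow> (\<integral>x. g x * \<psi> (e \<bullet> x) \<partial>L)"
    if g: "ridge_convergent \<mu> L g" and "\<And>x. 1 \<le> g x" for g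
  proof (rule tilted_projection_limit)
    show "(\<lambda>n. \<integral>x. g x * cos (\<theta> * (e \<bullet> x) + a) \<partial>\<mu> n)
                 \<longlonglongrightarrow> (\<integral>x. g x * cos (\<theta> * (e \<bullet> x) + a) \<partial>L)" for \<theta> a
      using g unfolding ridge_convergent_def inner_scaleR_left[symmetric] by blast
  qed (use that \<psi> in \<open>auto simp: ridge_convergent_def\<close>)
  have \<psi>e: "continuous_on UNIV (\<lambda>x. \<psi> (e \<bullet> x))" "bounded (range (\<lambda>x. \<psi> (e \<bullet> x)))"
    using \<psi> by (auto intro!: continuous_on_compose2[OF \<psi>(1)] continuous_intros intro: bounded_subset[of "range \<psi>"])
  have any: "(\<lambda>n. \<integral>x. g x * \<psi> (e \<bullet> x) \<partial>\<mu> n) \<longlonglongrightarrow> (\<integral>x. g x * \<psi> (e \<bullet> x) \<partial>L)"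
    if g: "ridge_convergent \<mu> L g" for g
  proof -
    obtain K where K: "\<And>x. \<bar>g x\<bar> \<le> K"
      using g by (auto simp: ridge_convergent_def bounded_iff)
    have "1 \<le> g x + (K + 1)" for x using K[of x] by linarith
    then have "(\<lambda>n. \<integral>x. (g x + 1 * (K + 1)) * \<psi> (e \<bullet> x) \<partial>\<mu> n) \<longlonglongrightarrow> (\<integral>x. (g x + 1 * (K + 1)) * \<psi> (e \<bullet> x) \<partial>L)"
      by (intro pos ridge_convergent_add g ridge_convergent_cmult one) auto
    moreover have "(\<lambda>n. \<integral>x. 1 * \<psi> (e \<bullet> x) \<partial>\<mu> n) \<longlonglongrightarrow> (\<integral>x. 1 * \<psi> (e \<bullet> x) \<partial>L)"
      by (intro pos one) auto
    ultimately have "(\<lambda>n. (\<integral>x. (g x + 1 * (K + 1)) * \<psi> (e \<bullet> x) \<partial>\<mu> n) - (K + 1) * (\<integral>x. 1 * \<psi> (e \<bullet> x) \<partial>\<mu> n))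
       \<longlonglongrightarrow> (\<integral>x. (g x + 1 * (K + 1)) * \<psi> (e \<bullet> x) \<partial>L) - (K + 1) * (\<integral>x. 1 * \<psi> (e \<bullet> x) \<partial>L)"
      by (intro tendsto_intros)
    moreover have c: "continuous_on UNIV (\<lambda>x. g x * \<psi> (e \<bullet> x))" "bounded (range (\<lambda>x. g x * \<psi> (e \<bullet> x)))"
      using g \<psi>e by (auto simp: ridge_convergent_def intro!: continuous_intros bounded_range_mult)
    ultimately show ?thesis
      by (simp add: distrib_right integrable_bc[OF c] integrable_bc[OF \<psi>e])
  qed
  \<comment> \<open>Since f times a cosine is again ridge convergent, \<open>any\<close> applied to
    that product supplies every frequency and phase.\<close>
  have "(\<lambda>n. \<integral>x. f x * \<psi> (e \<bullet> x) * cos (u \<bullet> x + a) \<partial>\<mu> n) \<longlonglongrightarrow> (\<integral>x. f x * \<psi> (e \<bullet> x) * cos (u \<bullet> x + a) \<partial>L)" for u a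
    using any[OF ridge_convergent_mult_cos[OF f, of u a]] by (simp add: mult.assoc mult.commute mult.left_commute)
  with f \<psi>e show ?thesis
    by (auto simp: ridge_convergent_def intro!: continuous_intros bounded_range_mult)
qed

section \<open>From polynomials on a cube to all bounded continuous functions\<close>

text \<open>Clamping acts on each coordinate separately, so every clamped coordinate is a bounded
  continuous function of some \<open>i \<bullet> x\<close> and may be multiplied into f. The factor
  f is kept arbitrary in the induction so that in the product case it can absorb the first
  polynomial.\<close>

lemma ridge_convergent_polynomial_clamp:
  assumes "real_polynomial_function p" and one: "ridge_convergent \<mu> L (\<lambda>_. 1)"
    and "ridge_convergent \<mu> L f" and R: "0 \<le> R"
  shows "ridge_convergent \<mu> L (\<lambda>x. f x * p (clamp (- R *\<^sub>R One) (R *\<^sub>R One) x))"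
  using assms(1,3)
proof (induction p arbitrary: f)
  case (linear l)
  interpret l: bounded_linear l by fact
  define c where "c y = max (- R) (min R y)" for y :: real
  have cc: "continuous_on UNIV c" "bounded (range c)"
    unfolding c_def using R by (auto intro!: continuous_intros exI[of _ R] simp: bounded_iff)
  have "clamp (- R *\<^sub>R One) (R *\<^sub>R One) x = (\<Sum>i\<in>Basis. c (i \<bullet> x) *\<^sub>R i)" for x :: 'v
    unfolding clamp_def inner_commute[of _ x] using R by (auto simp: c_def max_def min_def intro!: sum.cong)
  then have eq: "f x * l (clamp (- R *\<^sub>R One) (R *\<^sub>R One) x) = (\<Sum>i\<in>Basis. f x * c (i \<bullet> x) * l i)" for x
    by (simp add: l.sum l.scaleR sum_distrib_left mult.assoc)
  have zero: "ridge_convergent \<mu> L (\<lambda>x. 0)" by (simp add: ridge_convergent_def)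
  have "ridge_convergent \<mu> L (\<lambda>x. \<Sum>i\<in>A. f x * c (i \<bullet> x) * l i)" if "finite A" for A
    using that by (induction A)
      (auto intro!: zero ridge_convergent_add ridge_convergent_cmult ridge_convergent_mult_ridge linear one cc)
  then show ?case unfolding eq by simp
next
  case (const c)
  then show ?case by (intro ridge_convergent_cmult)
next
  case (add p q)
  then show ?case by (simp add: distrib_left ridge_convergent_add)
next
  case (mult p q)
  then show ?case using mult.IH(2)[OF mult.IH(1)[OF mult.prems]] by (simp add: mult.assoc)
qed

text \<open>After clamping only the values of f on a compact cube matter, and there
  Stone-Weierstrass gives a uniformly close polynomial. The error bound holds for every probability
  law at once, hence uniformly in n.\<close>

lemma integral_clamp_limit:
  fixes f :: "'v \<Rightarrow> real"
  assumes one: "ridge_convergent \<mu> L (\<lambda>_. 1)" and f: "continuous_on UNIV f" and R: "0 \<le> R"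
  shows "(\<lambda>n. \<integral>x. f (clamp (- R *\<^sub>R One) (R *\<^sub>R One) x) \<partial>\<mu> n)
           \<longlonglongrightarrow> (\<integral>x. f (clamp (- R *\<^sub>R One) (R *\<^sub>R One) x) \<partial>L)"
proof -
  let ?c = "clamp (- R *\<^sub>R One) (R *\<^sub>R One) :: 'v \<Rightarrow> 'v"
  have fc: "continuous_on UNIV (\<lambda>x. f (?c x))"
    by (intro clamp_continuous_on continuous_on_subset[OF f]) auto
  have fb: "bounded (range (\<lambda>x. f (?c x)))"
    by (intro clamp_bounded compact_imp_bounded compact_continuous_image compact_cbox continuous_on_subset[OF f]) auto
  show ?thesis
  proof (rule LIMSEQ_I)
    fix r :: real assume "0 < r"
    then obtain p where p: "real_polynomial_function p"
      and close: "\<And>x. x \<in> cbox (- R *\<^sub>R One) (R *\<^sub>R One) \<Longrightarrow> \<bar>f x - p x\<bar> < r / 3"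
      using Stone_Weierstrass_real_polynomial_function[OF compact_cbox continuous_on_subset[OF f subset_UNIV], of "r/3"]
      by auto
    have pr: "ridge_convergent \<mu> L (\<lambda>x. 1 * p (?c x))"
      by (rule ridge_convergent_polynomial_clamp[OF p one one R])
    then have pc: "continuous_on UNIV (\<lambda>x. p (?c x))" "bounded (range (\<lambda>x. p (?c x)))"
      by (auto simp: ridge_convergent_def)
    have lim: "(\<lambda>n. \<integral>x. p (?c x) \<partial>\<mu> n) \<longlonglongrightarrow> (\<integral>x. p (?c x) \<partial>L)"
      using pr unfolding ridge_convergent_def by (auto dest!: spec[of _ 0])
    have est: "\<bar>(\<integral>x. f (?c x) \<partial>\<nu>) - (\<integral>x. p (?c x) \<partial>\<nu>)\<bar> \<le> r / 3"
      if \<nu>: "prob_space \<nu>" "sets \<nu> = sets borel" for \<nu>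
    proof -
      interpret prob_space \<nu> by fact
      note int = integrable_bounded_continuous[OF \<nu> fc fb] integrable_bounded_continuous[OF \<nu> pc]
      have "\<bar>(\<integral>x. f (?c x) - p (?c x) \<partial>\<nu>)\<bar> \<le> (\<integral>x. \<bar>f (?c x) - p (?c x)\<bar> \<partial>\<nu>)"
        by (rule integral_abs_bound)
      also have "\<dots> \<le> (\<integral>x. r / 3 \<partial>\<nu>)"
        using int R close by (intro integral_mono) (auto intro!: less_imp_le clamp_in_interval)
      finally show ?thesis using int by (simp add: prob_space)
    qed
    obtain N where N: "\<And>n. n \<ge> N \<Longrightarrow> \<bar>(\<integral>x. p (?c x) \<partial>\<mu> n) - (\<integral>x. p (?c x) \<partial>L)\<bar> < r / 3"
      using LIMSEQ_D[OF lim, of "r/3"] \<open>0 < r\<close> by auto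
    show "\<exists>no. \<forall>n\<ge>no. norm ((\<integral>x. f (?c x) \<partial>\<mu> n) - (\<integral>x. f (?c x) \<partial>L)) < r"
    proof (intro exI[of _ N] allI impI)
      fix n assume "N \<le> n"
      from N[OF this] show "norm ((\<integral>x. f (?c x) \<partial>\<mu> n) - (\<integral>x. f (?c x) \<partial>L)) < r"
        using est[OF prob_L sets_L] est[OF prob_mu sets_mu, of n] unfolding real_norm_def by linarith
    qed
  qed
qed

text \<open>It remains to remove the clamp. The error is at most 2 B times the integral of a
  function T that dominates the indicator of the complement of the cube; T is a sum of ridge
  functions, so its integrals converge too, and smallness under L passes to the laws
  \<open>\<mu> n\<close>. This replaces a separate tightness argument.\<close>

theorem levy_continuity_euclidean:
  fixes f :: "'v \<Rightarrow> real"
  assumes cos_conv: "\<And>u a. (\<lambda>n. \<integral>x. cos (u \<bullet> x + a) \<partial>\<mu> n) \<longlonglongrightarrow> (\<integral>x. cos (u \<bullet> x + a) \<partial>L)"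
    and f: "continuous_on UNIV f" "bounded (range f)"
  shows "(\<lambda>n. \<integral>x. f x \<partial>\<mu> n) \<longlonglongrightarrow> (\<integral>x. f x \<partial>L)"
proof -
  have one: "ridge_convergent \<mu> L (\<lambda>_. 1)"
    using cos_conv by (simp add: ridge_convergent_def)
  obtain B where B: "\<And>x. \<bar>f x\<bar> \<le> B" and "0 \<le> B"
    using f(2) by (auto simp: bounded_iff) (meson abs_ge_zero order_trans)
  \<comment> \<open>A continuous cutoff: 0 for \<open>\<bar>y\<bar> \<le> R - 1\<close> and 1 for
    \<open>\<bar>y\<bar> \<ge> R\<close>. Hence \<open>T R\<close> is at least 1 outside the cube of
    half-width R.\<close>
  define \<tau> where "\<tau> R y = min 1 (max 0 (\<bar>y\<bar> - R + 1))" for R y :: real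
  define T where "T R x = (\<Sum>i\<in>Basis. \<tau> R (i \<bullet> x))" for R and x :: 'v
  have \<tau>c: "continuous_on UNIV (\<tau> R)" "bounded (range (\<tau> R))" for R
    unfolding \<tau>_def by (auto intro!: continuous_intros exI[of _ 1] simp: bounded_iff)
  have Tc: "continuous_on UNIV (T R)" for R
    unfolding T_def by (intro continuous_intros continuous_on_compose2[OF \<tau>c(1)]) auto
  have T_bound: "0 \<le> T R x" "T R x \<le> DIM('v)" for R x
    unfolding T_def using sum_bounded_above[of "Basis :: 'v set" "\<lambda>i. \<tau> R (i \<bullet> x)" 1]
    by (auto simp: \<tau>_def intro!: sum_nonneg)
  have Tb: "bounded (range (T R))" for R
    using T_bound by (auto simp: bounded_iff intro!: exI[of _ "real DIM('v)"])
  have T_lim: "(\<lambda>n. \<integral>x. T R x \<partial>\<mu> n) \<longlonglongrightarrow> (\<integral>x. T R x \<partial>L)" for R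
  proof -
    have r: "ridge_convergent \<mu> L (\<lambda>x. \<tau> R (i \<bullet> x))" for i :: 'v
      using ridge_convergent_mult_ridge[OF one one \<tau>c] by simp
    have c: "continuous_on UNIV (\<lambda>x. \<tau> R (i \<bullet> x))" "bounded (range (\<lambda>x. \<tau> R (i \<bullet> x)))" for i :: 'v
      using r[of i] unfolding ridge_convergent_def by blast+
    have "(\<lambda>n. \<integral>x. \<tau> R (i \<bullet> x) \<partial>\<mu> n) \<longlonglongrightarrow> (\<integral>x. \<tau> R (i \<bullet> x) \<partial>L)" for i :: 'v
      using r[of i] unfolding ridge_convergent_def by (auto dest!: spec[of _ 0])
    then show ?thesis
      unfolding T_def by (simp add: integrable_bc[OF c] tendsto_sum)
  qed
  interpret L: prob_space L by (rule prob_L)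
  \<comment> \<open>For fixed x all cutoffs vanish once k exceeds \<open>norm x + 1\<close>, and T
    is bounded by the dimension.\<close>
  have "(\<lambda>k. \<integral>x. T (real k) x \<partial>L) \<longlonglongrightarrow> (\<integral>x. 0 \<partial>L)"
  proof (rule integral_dominated_convergence[where w="\<lambda>_. DIM('v)"])
    show "(\<lambda>x. T (real k) x) \<in> borel_measurable L" for k
      using integrable_bc(2)[OF Tc Tb] by blast
    show "AE x in L. (\<lambda>k. T (real k) x) \<longlonglongrightarrow> 0"
    proof (rule AE_I2)
      fix x :: 'v
      have "eventually (\<lambda>k. T (real k) x = 0) sequentially"
        using eventually_ge_at_top[of "nat \<lceil>norm x + 1\<rceil>"]
      proof eventually_elim
        case (elim k)
        then have "norm x + 1 \<le> real k" by linarith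
        moreover have "\<bar>i \<bullet> x\<bar> \<le> norm x" if "i \<in> Basis" for i
          using Basis_le_norm[OF that, of x] by (simp add: inner_commute)
        ultimately show ?case unfolding T_def \<tau>_def by (intro sum.neutral) force
      qed
      then show "(\<lambda>k. T (real k) x) \<longlonglongrightarrow> 0" by (rule tendsto_eventually)
    qed
  qed (use T_bound in auto)
  then have T0: "(\<lambda>k. \<integral>x. T (real k) x \<partial>L) \<longlonglongrightarrow> 0" by simp
  show ?thesis
  proof (rule LIMSEQ_I)
    fix r :: real assume "0 < r"
    \<comment> \<open>Chosen to make \<open>2 * B * \<epsilon>\<close> less than
      \<open>r / 3\<close>; the summand 1 keeps the quotient meaningful for B = 0.\<close>
    define \<epsilon> where "\<epsilon> = r / (6 * (B + 1))"
    have "0 < \<epsilon>" using \<open>0 < r\<close> \<open>0 \<le> B\<close> by (simp add: \<epsilon>_def)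
    have "2 * B * \<epsilon> < r / 3"
    proof -
      have "2 * B * \<epsilon> = (r / 3) * (B / (B + 1))" using \<open>0 \<le> B\<close> by (simp add: \<epsilon>_def divide_simps)
      also have "\<dots> < (r / 3) * 1"
        using \<open>0 < r\<close> \<open>0 \<le> B\<close> by (intro mult_strict_left_mono) auto
      finally show ?thesis by simp
    qed
    \<comment> \<open>The cube is fixed by looking at L alone, before n is chosen;
      \<open>T_lim\<close> carries the bound over to \<open>\<mu> n\<close> for large n.\<close>
    obtain k where k: "(\<integral>x. T (real k) x \<partial>L) < \<epsilon>"
      using order_tendstoD(2)[OF T0 \<open>0 < \<epsilon>\<close>] by (auto simp: eventually_sequentially)
    define R where "R = real k"
    have "0 \<le> R" by (simp add: R_def)
    let ?c = "clamp (- R *\<^sub>R One) (R *\<^sub>R One) :: 'v \<Rightarrow> 'v"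
    have fc: "continuous_on UNIV (\<lambda>x. f (?c x))"
      by (intro clamp_continuous_on continuous_on_subset[OF f(1)]) auto
    have fb: "bounded (range (\<lambda>x. f (?c x)))" using B by (auto simp: bounded_iff)
    have pt: "\<bar>f x - f (?c x)\<bar> \<le> 2 * B * T R x" for x
    proof (cases "x \<in> cbox (- R *\<^sub>R One) (R *\<^sub>R One)")
      case True
      then show ?thesis using T_bound(1)[of R x] \<open>0 \<le> B\<close> by simp
    next
      case False
      then obtain i where "i \<in> Basis" "x \<bullet> i < - R \<or> R < x \<bullet> i"
        by (auto simp: mem_box not_le)
      then have i: "i \<in> Basis" "R < \<bar>i \<bullet> x\<bar>"
        by (auto simp: inner_commute)
      have "1 = \<tau> R (i \<bullet> x)" using i by (simp add: \<tau>_def)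
      also have "\<dots> \<le> T R x" unfolding T_def
        using i by (intro member_le_sum) (auto simp: \<tau>_def)
      finally have "2 * B * 1 \<le> 2 * B * T R x" using \<open>0 \<le> B\<close> by (intro mult_left_mono) auto
      then show ?thesis using B[of x] B[of "?c x"] by linarith
    qed
    have est: "\<bar>(\<integral>x. f x \<partial>\<nu>) - (\<integral>x. f (?c x) \<partial>\<nu>)\<bar> \<le> 2 * B * (\<integral>x. T R x \<partial>\<nu>)"
      if \<nu>: "prob_space \<nu>" "sets \<nu> = sets borel" for \<nu>
    proof -
      note int = integrable_bounded_continuous[OF \<nu> f] integrable_bounded_continuous[OF \<nu> fc fb]
        integrable_bounded_continuous[OF \<nu> Tc Tb]
      have "\<bar>(\<integral>x. f x - f (?c x) \<partial>\<nu>)\<bar> \<le> (\<integral>x. \<bar>f x - f (?c x)\<bar> \<partial>\<nu>)"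
        by (rule integral_abs_bound)
      also have "\<dots> \<le> (\<integral>x. 2 * B * T R x \<partial>\<nu>)"
        using int pt by (intro integral_mono) auto
      finally show ?thesis using int by simp
    qed
    have "eventually (\<lambda>n. (\<integral>x. T R x \<partial>\<mu> n) < \<epsilon>) sequentially"
      using order_tendstoD(2)[OF T_lim] k by (simp add: R_def)
    moreover have "eventually (\<lambda>n. \<bar>(\<integral>x. f (?c x) \<partial>\<mu> n) - (\<integral>x. f (?c x) \<partial>L)\<bar> < r / 3) sequentially"
      using tendstoD[OF integral_clamp_limit[OF one f(1) \<open>0 \<le> R\<close>], of "r/3"] \<open>0 < r\<close>
      by (simp add: dist_real_def)
    ultimately have "eventually (\<lambda>n. norm ((\<integral>x. f x \<partial>\<mu> n) - (\<integral>x. f x \<partial>L)) < r) sequentially"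
    proof eventually_elim
      case (elim n)
      have "2 * B * (\<integral>x. T R x \<partial>\<mu> n) \<le> 2 * B * \<epsilon>" "2 * B * (\<integral>x. T R x \<partial>L) \<le> 2 * B * \<epsilon>"
        using elim(1) k \<open>0 \<le> B\<close> by (auto intro!: mult_left_mono simp: R_def)
      then show ?case
        using est[OF prob_mu sets_mu, of n] est[OF prob_L sets_L] elim(2) \<open>2 * B * \<epsilon> < r / 3\<close>
        unfolding real_norm_def by linarith
    qed
    then show "\<exists>no. \<forall>n\<ge>no. norm ((\<integral>x. f x \<partial>\<mu> n) - (\<integral>x. f x \<partial>L)) < r"
      by (simp add: eventually_sequentially)
  qed
qed

end

section \<open>Gaussian laws from Brownian increments\<close>

lemma (in prob_space) expectation_iexp_normal:
  fixes X :: "'a \<Rightarrow> real"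
  assumes X: "distributed M lborel X (\<lambda>x. ennreal (normal_density 0 \<sigma> x))" and "0 < \<sigma>"
  shows "(\<integral>\<omega>. iexp (c * X \<omega>) \<partial>M) = complex_of_real (exp (- (c\<^sup>2 * \<sigma>\<^sup>2) / 2))"
proof -
  \<comment> \<open>Rescaling to unit variance multiplies the frequency by
    \<open>\<sigma>\<close>.\<close>
  have std: "distributed M lborel (\<lambda>\<omega>. (X \<omega> - 0) / \<sigma>) (\<lambda>x. ennreal (std_normal_density x))"
    using X \<open>0 < \<sigma>\<close> normal_standard_normal_convert by blast
  have [measurable]: "X \<in> borel_measurable M"
    using X by (auto simp: distributed_def)
  have "complex_of_real (exp (- (c * \<sigma>)\<^sup>2 / 2)) = char (distr M lborel (\<lambda>\<omega>. X \<omega> / \<sigma>)) (c * \<sigma>)"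
    using std by (simp add: distributed_def char_std_normal_distribution)
  also have "\<dots> = (\<integral>\<omega>. iexp (c * \<sigma> * (X \<omega> / \<sigma>)) \<partial>M)"
    unfolding char_def by (subst integral_distr) auto
  finally show ?thesis using \<open>0 < \<sigma>\<close> by (simp add: power_mult_distrib)
qed

lemma real_distribution_normal_law: "0 \<le> \<sigma> \<Longrightarrow> real_distribution (normal_law m \<sigma>)"
  by (auto simp: normal_law_def real_distribution_def real_distribution_axioms_def prob_space_return
      intro!: prob_space_normal_density)

lemma char_normal_law:
  assumes "0 \<le> \<sigma>"
  shows "char (normal_law 0 \<sigma>) t = complex_of_real (exp (- (t\<^sup>2 * \<sigma>\<^sup>2) / 2))"
proof (cases "\<sigma> = 0")
  case True
  then show ?thesis by (simp add: normal_law_def char_def integral_return)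
next
  case False
  then have "0 < \<sigma>" using assms by simp
  then interpret prob_space "density lborel (\<lambda>x. ennreal (normal_density 0 \<sigma> x))"
    by (rule prob_space_normal_density)
  have "distributed (density lborel (\<lambda>x. ennreal (normal_density 0 \<sigma> x))) lborel (\<lambda>x. x)
      (\<lambda>x. ennreal (normal_density 0 \<sigma> x))"
    by (auto simp: distributed_def intro!: distr_id2)
  from expectation_iexp_normal[OF this \<open>0 < \<sigma>\<close>] show ?thesis
    using False by (simp add: normal_law_def char_def)
qed

lemma sigma_sets_vimage_subset:
  assumes "f \<in> measurable N K" and "space N = S"
  shows "sigma_sets S {f -` A \<inter> S |A. A \<in> sets K} \<subseteq> sets N"
  unfolding assms(2)[symmetric]
  by (rule sets.sigma_sets_subset) (use measurable_sets[OF assms(1)] in auto)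

lemma (in prob_space) indep_set_mono:
  "indep_set A B \<Longrightarrow> A' \<subseteq> A \<Longrightarrow> B' \<subseteq> B \<Longrightarrow> indep_set A' B'"
  unfolding indep_sets2_eq by blast

section \<open>Characteristic functions of Brownian increments\<close>

locale brownian_filtration = prob_space M
  for M :: "'w measure" and F :: "real \<Rightarrow> 'w measure" and W :: "real \<Rightarrow> 'w \<Rightarrow> real ^ 'd::finite" +
  assumes filtration: "filtration_on M F"
    and brownian: "standard_brownian_motion M F W"
begin

lemma subalgebra_F: "0 \<le> t \<Longrightarrow> subalgebra M (F t)"
  and subalgebra_F_mono: "0 \<le> s \<Longrightarrow> s \<le> t \<Longrightarrow> subalgebra (F t) (F s)"
  using filtration by (auto simp: filtration_on_def)

lemma W_adapted: "0 \<le> t \<Longrightarrow> W t \<in> borel_measurable (F t)"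
  using brownian by (auto simp: standard_brownian_motion_def adapted_process_def)

lemma W_measurable: "0 \<le> t \<Longrightarrow> W t \<in> borel_measurable M"
  using measurable_from_subalg[OF subalgebra_F W_adapted] by blast

lemma
  assumes "0 \<le> s" "s < t"
  shows increment_indep_past: "indep_set (sets (F s)) (sets (vimage_algebra (space M) (\<lambda>\<omega>. W t \<omega> - W s \<omega>) borel))"
    and increment_indep_components: "indep_vars (\<lambda>_. borel) (\<lambda>i \<omega>. (W t \<omega> - W s \<omega>) $ i) UNIV"
    and increment_normal: "distributed M lborel (\<lambda>\<omega>. (W t \<omega> - W s \<omega>) $ i)
               (\<lambda>x. ennreal (normal_density 0 (sqrt (t - s)) x))"
  using brownian assms unfolding standard_brownian_motion_def by blast+

lemma expectation_iexp_increment: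
  assumes st: "0 \<le> s" "s < t"
  shows "(\<integral>\<omega>. iexp (u \<bullet> (W t \<omega> - W s \<omega>)) \<partial>M) = complex_of_real (exp (- ((norm u)\<^sup>2 * (t - s)) / 2))"
proof -
  let ?X = "\<lambda>i \<omega>. iexp (u $ i * (W t \<omega> - W s \<omega>) $ i)"
  have ind: "indep_vars (\<lambda>_. borel) ?X UNIV"
    by (rule indep_vars_compose2[OF increment_indep_components[OF st]]) measurable
  then have "random_variable borel (?X i)" for i by (simp add: indep_vars_def)
  then have int: "integrable M (?X i)" for i
    by (intro integrable_const_bound[where B=1]) auto
  have "(\<integral>\<omega>. iexp (u \<bullet> (W t \<omega> - W s \<omega>)) \<partial>M) = (\<integral>\<omega>. (\<Prod>i\<in>UNIV. ?X i \<omega>) \<partial>M)"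
    by (simp add: inner_vec_def sum_distrib_left exp_sum)
  also have "\<dots> = (\<Prod>i\<in>UNIV. \<integral>\<omega>. ?X i \<omega> \<partial>M)"
    by (rule indep_vars_lebesgue_integral) (use ind int in auto)
  also have "\<dots> = (\<Prod>i\<in>UNIV. complex_of_real (exp (- ((u $ i)\<^sup>2 * (t - s)) / 2)))"
    using st by (intro prod.cong refl, subst expectation_iexp_normal[OF increment_normal[OF st]]) auto
  also have "\<dots> = complex_of_real (exp (\<Sum>i\<in>UNIV. - ((u $ i)\<^sup>2 * (t - s)) / 2))"
    by (simp add: exp_sum)
  also have "(\<Sum>i\<in>UNIV. - ((u $ i)\<^sup>2 * (t - s)) / 2) = - ((norm u)\<^sup>2 * (t - s)) / 2"
    by (simp add: power2_norm_eq_inner inner_vec_def sum_divide_distrib sum_negf sum_distrib_right power2_eq_square[of "u $ _"])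
  finally show ?thesis .
qed

text \<open>An increment after time s is independent of everything measurable at time s, so the
  expectation factorises; boundedness of Z makes it integrable.\<close>

lemma expectation_mult_iexp_increment:
  fixes Z :: "'w \<Rightarrow> complex"
  assumes st: "0 \<le> s" "s < t" and Z: "Z \<in> borel_measurable (F s)" and bound: "\<And>\<omega>. norm (Z \<omega>) \<le> B"
  shows "(\<integral>\<omega>. Z \<omega> * iexp (u \<bullet> (W t \<omega> - W s \<omega>)) \<partial>M) =
           (\<integral>\<omega>. Z \<omega> \<partial>M) * complex_of_real (exp (- ((norm u)\<^sup>2 * (t - s)) / 2))"
proof -
  let ?V = "vimage_algebra (space M) (\<lambda>\<omega>. W t \<omega> - W s \<omega>) borel"
  let ?I = "\<lambda>\<omega>. iexp (u \<bullet> (W t \<omega> - W s \<omega>))"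
  have [measurable]: "W t \<in> borel_measurable M" "W s \<in> borel_measurable M"
    using st by (auto intro: W_measurable)
  have ZM [measurable]: "Z \<in> borel_measurable M"
    using measurable_from_subalg[OF subalgebra_F Z] st by blast
  have sp: "space (F s) = space M" "space ?V = space M"
    using subalgebra_F[of s] st by (auto simp: subalgebra_def)
  have [measurable]: "(\<lambda>\<omega>. W t \<omega> - W s \<omega>) \<in> borel_measurable ?V"
    by (rule measurable_vimage_algebra1) auto
  have IV: "?I \<in> borel_measurable ?V" by measurable
  \<comment> \<open>Independence is given for whole sigma-algebras; it is inherited by the smaller
    ones that Z and the exponential generate.\<close>
  have 1: "sigma_sets (space M) {Z -` A \<inter> space M |A. A \<in> sets borel} \<subseteq> sets (F s)"
    by (rule sigma_sets_vimage_subset[OF Z sp(1)])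
  have 2: "sigma_sets (space M) {?I -` A \<inter> space M |A. A \<in> sets borel} \<subseteq> sets ?V"
    by (rule sigma_sets_vimage_subset[OF IV sp(2)])
  have "indep_var borel Z borel ?I"
    unfolding indep_var_eq
  proof (intro conjI)
    show "indep_set (sigma_sets (space M) {Z -` A \<inter> space M |A. A \<in> sets borel})
        (sigma_sets (space M) {?I -` A \<inter> space M |A. A \<in> sets borel})"
      by (rule indep_set_mono[OF increment_indep_past[OF st] 1 2])
  qed measurable
  then have "(\<integral>\<omega>. Z \<omega> * ?I \<omega> \<partial>M) = (\<integral>\<omega>. Z \<omega> \<partial>M) * (\<integral>\<omega>. ?I \<omega> \<partial>M)"
  proof (rule indep_var_lebesgue_integral)
    show "integrable M Z" by (rule integrable_const_bound[where B=B]) (auto simp: bound)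
    show "integrable M ?I" by (rule integrable_const_bound[where B=1]) auto
  qed
  then show ?thesis by (simp add: expectation_iexp_increment[OF st])
qed

text \<open>By induction the last increment is split off, the earlier sum being measurable at time
  \<open>t m\<close>. The times increase strictly because the law of an increment is prescribed only
  for \<open>s < t\<close>.\<close>

lemma expectation_iexp_sum_increments:
  fixes t :: "nat \<Rightarrow> real" and w :: "nat \<Rightarrow> real ^ 'd"
  assumes t: "0 \<le> t 0" "\<And>k. t k < t (Suc k)"
  shows "(\<integral>\<omega>. iexp (\<Sum>k<m. w k \<bullet> (W (t (Suc k)) \<omega> - W (t k) \<omega>)) \<partial>M) =
           complex_of_real (exp (- (\<Sum>k<m. (norm (w k))\<^sup>2 * (t (Suc k) - t k)) / 2))"
proof (induction m)
  case 0
  then show ?case by (simp add: prob_space)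
next
  case (Suc m)
  have mono: "t j \<le> t k" if "j \<le> k" for j k
    using t(2) by (intro lift_Suc_mono_le[OF _ that]) (auto intro: less_imp_le)
  have pos: "0 \<le> t k" for k using mono[of 0 k] t(1) by simp
  have [measurable]: "W (t k) \<in> borel_measurable (F (t m))" if "k \<le> m" for k
    using measurable_from_subalg[OF subalgebra_F_mono[OF pos mono[OF that]] W_adapted[OF pos]] .
  have Z: "(\<lambda>\<omega>. iexp (\<Sum>k<m. w k \<bullet> (W (t (Suc k)) \<omega> - W (t k) \<omega>))) \<in> borel_measurable (F (t m))"
    by measurable
  have "(\<integral>\<omega>. iexp (\<Sum>k<Suc m. w k \<bullet> (W (t (Suc k)) \<omega> - W (t k) \<omega>)) \<partial>M) =
      (\<integral>\<omega>. iexp (\<Sum>k<m. w k \<bullet> (W (t (Suc k)) \<omega> - W (t k) \<omega>)) * iexp (w m \<bullet> (W (t (Suc m)) \<omega> - W (t m) \<omega>)) \<partial>M)"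
    by (simp add: exp_add[symmetric] distrib_left)
  also have "\<dots> = complex_of_real (exp (- (\<Sum>k<m. (norm (w k))\<^sup>2 * (t (Suc k) - t k)) / 2)) *
      complex_of_real (exp (- ((norm (w m))\<^sup>2 * (t (Suc m) - t m)) / 2))"
    by (subst expectation_mult_iexp_increment[OF pos t(2) Z, of 1]) (simp_all add: Suc del: of_real_sum)
  also have "\<dots> = complex_of_real (exp (- (\<Sum>k<Suc m. (norm (w k))\<^sup>2 * (t (Suc k) - t k)) / 2))"
    by (simp add: exp_add[symmetric] of_real_mult[symmetric] add_divide_distrib del: of_real_mult)
  finally show ?case .
qed

section \<open>Moments of increments\<close>

lemma increment_square_integrable:
  assumes st: "0 \<le> s" "s < t"
  shows "integrable M (\<lambda>\<omega>. ((W t \<omega> - W s \<omega>) $ i)\<^sup>2)"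
  using integrable_normal_moment[of "sqrt (t - s)" 0 2] st
  by (subst distributed_integrable[OF increment_normal[OF st], symmetric]) auto

text \<open>Convergence is proved through characteristic functions alone; these moments serve to
  compute the mean and the covariances of the limit law.\<close>

lemma
  assumes st: "0 \<le> s" "s < t"
  shows increment_integrable: "integrable M (\<lambda>\<omega>. (W t \<omega> - W s \<omega>) $ i)"
    and increment_prod_integrable: "integrable M (\<lambda>\<omega>. (W t \<omega> - W s \<omega>) $ i * (W t \<omega> - W s \<omega>) $ j)"
    and increment_mean: "(\<integral>\<omega>. (W t \<omega> - W s \<omega>) $ i \<partial>M) = 0"
    and increment_cov: "(\<integral>\<omega>. (W t \<omega> - W s \<omega>) $ i * (W t \<omega> - W s \<omega>) $ j \<partial>M) = (if i = j then t - s else 0)"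
proof -
  let ?X = "\<lambda>i \<omega>. (W t \<omega> - W s \<omega>) $ i"
  have sd: "0 < sqrt (t - s)" using st by simp
  show int: "integrable M (?X i)" for i
    using integrable_normal_moment_nz_1[OF sd, of 0] st
    by (subst distributed_integrable[OF increment_normal[OF st], symmetric]) auto
  show mean: "(\<integral>\<omega>. ?X i \<omega> \<partial>M) = 0" for i
    by (rule normal_distributed_expectation[OF sd increment_normal[OF st]])
  have var: "(\<integral>\<omega>. ?X i \<omega> * ?X i \<omega> \<partial>M) = t - s" for i
    using normal_distributed_variance[OF sd increment_normal[OF st]] st mean by (simp add: power2_eq_square)
  have ind: "indep_vars (\<lambda>_. borel) ?X {i, j}"
    using indep_vars_subset[OF increment_indep_components[OF st]] by auto
  show "integrable M (\<lambda>\<omega>. ?X i \<omega> * ?X j \<omega>)"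
    using increment_square_integrable[OF st, of i] indep_vars_integrable[OF _ ind int]
    by (cases "i = j") (auto simp: power2_eq_square)
  show "(\<integral>\<omega>. ?X i \<omega> * ?X j \<omega> \<partial>M) = (if i = j then t - s else 0)"
    using indep_vars_lebesgue_integral[OF _ ind int] var mean by (cases "i = j") auto
qed

lemma
  assumes st: "0 \<le> s" "s < t"
  shows inner_increment_mean: "(\<integral>\<omega>. a \<bullet> (W t \<omega> - W s \<omega>) \<partial>M) = 0"
    and inner_increment_cov: "(\<integral>\<omega>. (a \<bullet> (W t \<omega> - W s \<omega>)) * (b \<bullet> (W t \<omega> - W s \<omega>)) \<partial>M) = (t - s) * (a \<bullet> b)"
proof -
  define X where "X i \<omega> = (W t \<omega> - W s \<omega>) $ i" for i \<omega>
  show "(\<integral>\<omega>. a \<bullet> (W t \<omega> - W s \<omega>) \<partial>M) = 0"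
    unfolding inner_vec_def using increment_integrable[OF st] increment_mean[OF st] by simp
  have eq: "(a \<bullet> (W t \<omega> - W s \<omega>)) * (b \<bullet> (W t \<omega> - W s \<omega>)) =
      (\<Sum>i\<in>UNIV. \<Sum>j\<in>UNIV. (a $ i * b $ j) * (X i \<omega> * X j \<omega>))" for \<omega>
    unfolding inner_vec_def sum_product X_def[symmetric] by (simp add: ac_simps)
  have "(\<integral>\<omega>. (a \<bullet> (W t \<omega> - W s \<omega>)) * (b \<bullet> (W t \<omega> - W s \<omega>)) \<partial>M) =
      (\<Sum>i\<in>UNIV. \<Sum>j\<in>UNIV. (a $ i * b $ j) * (if i = j then t - s else 0))"
    unfolding eq using increment_prod_integrable[OF st, folded X_def]
    by (simp add: increment_cov[OF st, folded X_def])
  also have "\<dots> = (\<Sum>i\<in>UNIV. (t - s) * (a $ i * b $ i))"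
    by (simp add: if_distrib mult.commute cong: if_cong)
  finally show "(\<integral>\<omega>. (a \<bullet> (W t \<omega> - W s \<omega>)) * (b \<bullet> (W t \<omega> - W s \<omega>)) \<partial>M) = (t - s) * (a \<bullet> b)"
    by (simp add: inner_vec_def sum_distrib_left)
qed

text \<open>The increment over a unit interval serves as a standard normal vector, so that a centred normal
  law with covariance \<open>R R\<^sup>T\<close> can be realised on the given probability space.\<close>

definition gaussian_law :: "real ^ 'd ^ 'd \<Rightarrow> (real ^ 'd) measure" where
  "gaussian_law R = distr M borel (\<lambda>\<omega>. R *v (W 1 \<omega> - W 0 \<omega>))"

lemma gaussian_vector_measurable [measurable]: "(\<lambda>\<omega>. R *v (W 1 \<omega> - W 0 \<omega>)) \<in> borel_measurable M"
proof -
  have [measurable]: "W 1 \<in> borel_measurable M" "W 0 \<in> borel_measurable M"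
    by (auto intro: W_measurable)
  have "(\<lambda>x. R *v x) \<in> borel_measurable borel"
    by (intro borel_measurable_continuous_onI linear_continuous_on matrix_vector_mul_bounded_linear)
  then show ?thesis by measurable
qed

lemma prob_space_gaussian_law: "prob_space (gaussian_law R)"
  unfolding gaussian_law_def by (rule prob_space_distr) measurable

lemma sets_gaussian_law [simp, measurable_cong]: "sets (gaussian_law R) = sets borel"
  by (simp add: gaussian_law_def)

lemma iexp_gaussian_law:
  "(\<integral>x. iexp (u \<bullet> x) \<partial>gaussian_law R) = complex_of_real (exp (- (u \<bullet> ((R ** transpose R) *v u)) / 2))"
proof -
  have "(\<integral>x. iexp (u \<bullet> x) \<partial>gaussian_law R) = (\<integral>\<omega>. iexp (u \<bullet> (R *v (W 1 \<omega> - W 0 \<omega>))) \<partial>M)"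
    unfolding gaussian_law_def by (rule integral_distr) measurable
  also have "\<dots> = (\<integral>\<omega>. iexp ((transpose R *v u) \<bullet> (W 1 \<omega> - W 0 \<omega>)) \<partial>M)"
    by (simp add: dot_lmul_matrix[symmetric] transpose_matrix_vector)
  also have "\<dots> = complex_of_real (exp (- ((norm (transpose R *v u))\<^sup>2 * (1 - 0)) / 2))"
    by (rule expectation_iexp_increment) auto
  also have "(norm (transpose R *v u))\<^sup>2 = u \<bullet> ((R ** transpose R) *v u)"
    by (simp add: power2_norm_eq_inner matrix_vector_mul_assoc[symmetric] dot_lmul_matrix[symmetric] transpose_matrix_vector)
  finally show ?thesis by simp
qed

lemma multivariate_normal_gaussian_law: "multivariate_normal (gaussian_law R)"
  unfolding multivariate_normal_def
proof (intro conjI allI)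
  fix u :: "real ^ 'd"
  interpret G: prob_space "gaussian_law R" by (rule prob_space_gaussian_law)
  \<comment> \<open>The standard deviation of the projection to u. It vanishes when u lies in the
    kernel of \<open>transpose R\<close>, and then the projected law is a point mass, which
    \<open>char_normal_law\<close> covers.\<close>
  define \<sigma> where "\<sigma> = norm (transpose R *v u)"
  have \<sigma>: "0 \<le> \<sigma>" "\<sigma>\<^sup>2 = u \<bullet> ((R ** transpose R) *v u)"
    by (simp_all add: \<sigma>_def power2_norm_eq_inner matrix_vector_mul_assoc[symmetric] dot_lmul_matrix[symmetric] transpose_matrix_vector)
  have "distr (gaussian_law R) borel (\<lambda>x. u \<bullet> x) = normal_law 0 \<sigma>"
  proof (rule Levy_uniqueness)
    show "real_distribution (distr (gaussian_law R) borel (\<lambda>x. u \<bullet> x))"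
      by (simp add: real_distribution_def real_distribution_axioms_def G.prob_space_distr)
    show "real_distribution (normal_law 0 \<sigma>)" by (rule real_distribution_normal_law[OF \<sigma>(1)])
    show "char (distr (gaussian_law R) borel (\<lambda>x. u \<bullet> x)) = char (normal_law 0 \<sigma>)"
    proof
      fix \<theta>
      have "char (distr (gaussian_law R) borel (\<lambda>x. u \<bullet> x)) \<theta> = (\<integral>x. iexp (\<theta> * (u \<bullet> x)) \<partial>gaussian_law R)"
        unfolding char_def by (rule integral_distr) measurable
      also have "\<dots> = complex_of_real (exp (- (\<theta>\<^sup>2 * \<sigma>\<^sup>2) / 2))"
        using iexp_gaussian_law[where u="\<theta> *\<^sub>R u" and R=R]
        by (simp add: \<sigma>(2) matrix_vector_mult_scaleR power2_eq_square[of \<theta>] mult.assoc)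
      also have "\<dots> = char (normal_law 0 \<sigma>) \<theta>" by (rule char_normal_law[OF \<sigma>(1), symmetric])
      finally show "char (distr (gaussian_law R) borel (\<lambda>x. u \<bullet> x)) \<theta> = char (normal_law 0 \<sigma>) \<theta>" .
    qed
  qed
  then show "\<exists>m \<sigma>. 0 \<le> \<sigma> \<and> distr (gaussian_law R) borel (\<lambda>x. u \<bullet> x) = normal_law m \<sigma>"
    using \<sigma>(1) by blast
qed (auto simp: prob_space_gaussian_law)

lemma mean_gaussian_law: "(\<integral>x. x $ k \<partial>gaussian_law R) = 0"
proof -
  have "(\<integral>x. x $ k \<partial>gaussian_law R) = (\<integral>\<omega>. (R *v (W 1 \<omega> - W 0 \<omega>)) $ k \<partial>M)"
    unfolding gaussian_law_def by (rule integral_distr) measurable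
  then show ?thesis
    using inner_increment_mean[of 0 1 "R $ k"] by (simp add: matrix_vector_mul_component)
qed

lemma covariance_gaussian_law:
  "covariance (gaussian_law R) (\<lambda>x. x $ k) (\<lambda>x. x $ l) = (R ** transpose R) $ k $ l"
proof -
  have "covariance (gaussian_law R) (\<lambda>x. x $ k) (\<lambda>x. x $ l) = (\<integral>x. x $ k * x $ l \<partial>gaussian_law R)"
    by (simp add: covariance_def mean_gaussian_law)
  also have "\<dots> = (\<integral>\<omega>. (R *v (W 1 \<omega> - W 0 \<omega>)) $ k * (R *v (W 1 \<omega> - W 0 \<omega>)) $ l \<partial>M)"
    unfolding gaussian_law_def by (rule integral_distr) measurable
  also have "\<dots> = R $ k \<bullet> R $ l"
    using inner_increment_cov[of 0 1 "R $ k" "R $ l"] by (simp add: matrix_vector_mul_component)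
  finally show ?thesis
    by (simp add: matrix_matrix_mult_def transpose_def inner_vec_def)
qed

lemma variance_gaussian_law:
  "prob_space.variance (gaussian_law R) (\<lambda>x. x $ k) = (R ** transpose R) $ k $ k"
  using covariance_gaussian_law[of R k k] by (simp add: covariance_def power2_eq_square)

end

section \<open>Linear equations with additive noise\<close>

lemma integral_grid_sum:
  fixes f :: "real \<Rightarrow> 'a::banach" and g :: "nat \<Rightarrow> real"
  assumes g: "\<And>k. g k \<le> g (Suc k)" and f: "f integrable_on {g 0..g m}"
  shows "integral {g 0..g m} f = (\<Sum>k<m. integral {g k..g (Suc k)} f)"
  using f
proof (induction m)
  case (Suc m)
  have "g 0 \<le> g m" by (rule lift_Suc_mono_le[of g]) (auto simp: g)
  then have "f integrable_on {g 0..g m}"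
    using integrable_on_subinterval[OF Suc.prems] g[of m] by auto
  then show ?case
    using Henstock_Kurzweil_Integration.integral_combine[OF \<open>g 0 \<le> g m\<close> g[of m] Suc.prems] Suc.IH by simp
qed simp

text \<open>Index n stands for \<open>Suc n\<close> cells of equal length, so that n = 0 is a
  partition too.\<close>

definition grid :: "real \<Rightarrow> nat \<Rightarrow> nat \<Rightarrow> real" where
  "grid t n k = t * real k / real (Suc n)"

lemma
  assumes "0 < t"
  shows grid_0: "grid t n 0 = 0" and grid_last: "grid t n (Suc n) = t"
    and grid_less: "grid t n k < grid t n (Suc k)"
    and grid_diff: "grid t n (Suc k) - grid t n k = t / real (Suc n)"
    and grid_nonneg: "0 \<le> grid t n k"
    and grid_le: "k \<le> Suc n \<Longrightarrow> grid t n k \<le> t"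
proof -
  show diff: "grid t n (Suc k) - grid t n k = t / real (Suc n)"
    by (simp add: grid_def diff_divide_distrib[symmetric] algebra_simps)
  then show "grid t n k < grid t n (Suc k)"
    using divide_pos_pos[OF assms, of "real (Suc n)"] by simp
  have "t * real k \<le> t * real (Suc n)" if "k \<le> Suc n"
    using assms that by (intro mult_left_mono) auto
  then show "k \<le> Suc n \<Longrightarrow> grid t n k \<le> t" by (simp add: grid_def divide_le_eq)
qed (use assms in \<open>auto simp: grid_def\<close>)

text \<open>On each cell the first argument of h is integrated while the second is frozen at the
  tag; uniform continuity on the square controls the difference to the diagonal. This one form
  covers both later uses: a path frozen at right endpoints, and a squared weight frozen at left
  endpoints.\<close>

lemma riemann_sum_limit:
  fixes h :: "real \<Rightarrow> real \<Rightarrow> real"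
  assumes t: "0 < t" and h: "continuous_on ({0..t} \<times> {0..t}) (\<lambda>(s, r). h s r)"
    and tag: "\<And>n k. k \<le> n \<Longrightarrow> tag n k \<in> {grid t n k..grid t n (Suc k)}"
  shows "(\<lambda>n. \<Sum>k<Suc n. integral {grid t n k..grid t n (Suc k)} (\<lambda>s. h s (tag n k)))
           \<longlonglongrightarrow> integral {0..t} (\<lambda>s. h s s)"
proof (rule LIMSEQ_I)
  fix r :: real assume "0 < r"
  \<comment> \<open>The errors of the cells add up to \<open>\<epsilon> * t\<close>, which is r /
    2.\<close>
  define \<epsilon> where "\<epsilon> = r / (2 * t)"
  have "0 < \<epsilon>" using \<open>0 < r\<close> t by (simp add: \<epsilon>_def)
  have "uniformly_continuous_on ({0..t} \<times> {0..t}) (\<lambda>(s, r). h s r)"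
    by (intro compact_uniformly_continuous h compact_Times compact_Icc)
  then obtain d where "0 < d" and
    "\<forall>x\<in>{0..t} \<times> {0..t}. \<forall>x'\<in>{0..t} \<times> {0..t}. dist x' x < d \<longrightarrow> dist (case x' of (s, r) \<Rightarrow> h s r) (case x of (s, r) \<Rightarrow> h s r) < \<epsilon>"
    unfolding uniformly_continuous_on_def using \<open>0 < \<epsilon>\<close> by blast
  then have d: "\<bar>h s q - h s s\<bar> < \<epsilon>" if "s \<in> {0..t}" "q \<in> {0..t}" "\<bar>q - s\<bar> < d" for s q
    using that by (fastforce simp: dist_Pair_Pair dist_real_def)
  have hc: "continuous_on {0..t} (\<lambda>s. h s q)" if "q \<in> {0..t}" for q
    by (rule continuous_on_compose2[OF h, of _ "\<lambda>s. (s, q)", simplified])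
       (use that in \<open>auto intro!: continuous_intros\<close>)
  have hd: "continuous_on {0..t} (\<lambda>s. h s s)"
    by (rule continuous_on_compose2[OF h, of _ "\<lambda>s. (s, s)", simplified])
       (auto intro!: continuous_intros)
  obtain N where N: "t / d < real N" using reals_Archimedean2 by blast
  show "\<exists>no. \<forall>n\<ge>no. norm ((\<Sum>k<Suc n. integral {grid t n k..grid t n (Suc k)} (\<lambda>s. h s (tag n k)))
      - integral {0..t} (\<lambda>s. h s s)) < r"
  proof (intro exI[of _ N] allI impI)
    fix n assume "N \<le> n"
    then have "t / d < real (Suc n)" using N by simp
    then have mesh: "t / real (Suc n) < d" using \<open>0 < d\<close> t by (simp add: field_simps)
    let ?I = "\<lambda>k. {grid t n k..grid t n (Suc k)}"
    have sub: "?I k \<subseteq> {0..t}" if "k \<le> n" for k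
      using grid_nonneg[OF t, of n k] grid_le[OF t, of "Suc k" n] that by auto
    have "integral {0..t} (\<lambda>s. h s s) = (\<Sum>k<Suc n. integral (?I k) (\<lambda>s. h s s))"
      using integral_grid_sum[of "grid t n" "\<lambda>s. h s s" "Suc n"] integrable_continuous_interval[OF hd]
      by (simp add: grid_0[OF t] grid_last[OF t] grid_less[OF t] less_imp_le)
    then have "(\<Sum>k<Suc n. integral (?I k) (\<lambda>s. h s (tag n k))) - integral {0..t} (\<lambda>s. h s s)
        = (\<Sum>k<Suc n. integral (?I k) (\<lambda>s. h s (tag n k)) - integral (?I k) (\<lambda>s. h s s))"
      by (simp add: sum_subtractf)
    also have "norm \<dots> \<le> (\<Sum>k<Suc n. \<epsilon> * (t / real (Suc n)))"
    proof (rule sum_norm_le)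
      fix k assume "k \<in> {..<Suc n}"
      then have "k \<le> n" by simp
      have tg: "tag n k \<in> {0..t}" using tag[OF \<open>k \<le> n\<close>] sub[OF \<open>k \<le> n\<close>] by blast
      have c: "continuous_on (?I k) (\<lambda>s. h s (tag n k))" "continuous_on (?I k) (\<lambda>s. h s s)"
        using continuous_on_subset[OF hc[OF tg] sub[OF \<open>k \<le> n\<close>]] continuous_on_subset[OF hd sub[OF \<open>k \<le> n\<close>]] by auto
      have "norm (integral (?I k) (\<lambda>s. h s (tag n k) - h s s)) \<le> \<epsilon> * (grid t n (Suc k) - grid t n k)"
      proof (rule integral_bound)
        fix s assume s: "s \<in> ?I k"
        then have "\<bar>tag n k - s\<bar> \<le> t / real (Suc n)"
          using tag[OF \<open>k \<le> n\<close>] grid_diff[OF t, of n k] by auto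
        then show "norm (h s (tag n k) - h s s) \<le> \<epsilon>"
          using d[of s "tag n k"] s sub[OF \<open>k \<le> n\<close>] tg mesh by (auto intro!: less_imp_le)
      qed (use c grid_less[OF t] in \<open>auto intro!: continuous_intros less_imp_le\<close>)
      then show "norm (integral (?I k) (\<lambda>s. h s (tag n k)) - integral (?I k) (\<lambda>s. h s s)) \<le> \<epsilon> * (t / real (Suc n))"
        using c by (simp add: grid_diff[OF t] Henstock_Kurzweil_Integration.integral_diff integrable_continuous_interval)
    qed
    also have "\<dots> = \<epsilon> * t" by simp
    also have "\<dots> < r" using \<open>0 < r\<close> t by (simp add: \<epsilon>_def)
    finally show "norm ((\<Sum>k<Suc n. integral (?I k) (\<lambda>s. h s (tag n k))) - integral {0..t} (\<lambda>s. h s s)) < r" .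
  qed
qed

section \<open>Pathwise integration by parts along the adjoint flow\<close>

lemma inner_matrix_vector: "(x::real^'n) \<bullet> (A *v y) = (transpose A *v x) \<bullet> y"
  by (simp add: dot_lmul_matrix[symmetric] transpose_matrix_vector)

text \<open>Summation by parts shifts the differences from x, later a Brownian path, to w, later a
  smooth weight. The remaining sum takes x at \<open>Suc k\<close>, which is why right endpoints
  occur as tags.\<close>

lemma abel_summation_inner:
  fixes w x :: "nat \<Rightarrow> 'a::real_inner"
  shows "(\<Sum>k<m. w k \<bullet> (x (Suc k) - x k)) = w m \<bullet> x m - w 0 \<bullet> x 0 - (\<Sum>k<m. (w (Suc k) - w k) \<bullet> x (Suc k))"
  by (induction m) (auto simp: inner_diff_left inner_diff_right)

lemma has_vector_derivative_reflect:
  fixes t :: real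
  assumes "\<And>s. (v has_vector_derivative v' s) (at s)"
  shows "((\<lambda>s. v (t - s)) has_vector_derivative - v' (t - s)) (at s within T)"
proof -
  have "((\<lambda>s. t - s) has_vector_derivative - 1) (at s within T)"
    by (auto intro!: derivative_eq_intros)
  from vector_diff_chain_within[OF this has_vector_derivative_at_within[OF assms]]
  show ?thesis by (simp add: o_def)
qed

text \<open>For a solution \<open>v\<close> of the adjoint equation, \<open>s \<mapsto> v (t - s) \<bullet> (y s - D x s)\<close> has a derivative
  in which \<open>y\<close> cancels.\<close>

lemma variation_of_constants:
  fixes x y v :: "real \<Rightarrow> real ^ 'd"
  assumes t: "0 \<le> t" and x: "continuous_on {0..t} x" and y: "continuous_on {0..t} y"
    and eq: "\<And>s. 0 \<le> s \<Longrightarrow> s \<le> t \<Longrightarrow> y s = y 0 - integral {0..s} (\<lambda>r. P *v y r) + D *v x s"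
    and v: "\<And>s. (v has_vector_derivative - (transpose P *v v s)) (at s)"
  shows "v 0 \<bullet> y t = v t \<bullet> y 0 + (v 0 \<bullet> (D *v x t)
           - integral {0..t} (\<lambda>s. (transpose P *v v (t - s)) \<bullet> (D *v x s)))"
proof -
  \<comment> \<open>This is y with the noise \<open>D *v x\<close> removed; unlike y it is
    differentiable.\<close>
  define z where "z s = y 0 - integral {0..s} (\<lambda>r. P *v y r)" for s
  have Py: "continuous_on {0..t} (\<lambda>r. P *v y r)"
    by (rule continuous_on_compose2[OF matrix_vector_mult_linear_continuous_on y]) auto
  have zd: "(z has_vector_derivative - (P *v y s)) (at s within {0..t})" if "s \<in> {0..t}" for s
    unfolding z_def
    by (rule derivative_eq_intros integral_has_vector_derivative[OF Py that] refl | simp)+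
  have vd: "((\<lambda>s. v (t - s)) has_vector_derivative (transpose P *v v (t - s))) (at s within {0..t})" for s
  using has_vector_derivative_reflect[OF v, of t] by simp
  have "((\<lambda>s. v (t - s) \<bullet> z s) has_vector_derivative - ((transpose P *v v (t - s)) \<bullet> (D *v x s))) (at s within {0..t})"
    if s: "s \<in> {0..t}" for s
  proof -
    have "y s = z s + D *v x s" using eq[of s] s by (simp add: z_def)
    then have "(v (t - s)) \<bullet> (- (P *v y s)) + (transpose P *v v (t - s)) \<bullet> z s
        = - ((transpose P *v v (t - s)) \<bullet> (D *v x s))"
      by (simp add: inner_matrix_vector[of _ P] inner_right_distrib)
    then show ?thesis
      using bounded_bilinear.has_vector_derivative[OF bounded_bilinear_inner vd zd[OF s]] by simp
  qed
  then have "((\<lambda>s. - ((transpose P *v v (t - s)) \<bullet> (D *v x s))) has_integral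
      v (t - t) \<bullet> z t - v (t - 0) \<bullet> z 0) {0..t}"
    by (rule fundamental_theorem_of_calculus[OF t])
  from integral_unique[OF this]
  have "- integral {0..t} (\<lambda>s. (transpose P *v v (t - s)) \<bullet> (D *v x s)) = v 0 \<bullet> z t - v t \<bullet> z 0"
    by simp
  moreover have "z 0 = y 0" by (simp add: z_def)
  moreover have "y t = z t + D *v x t" using eq[of t] t by (simp add: z_def)
  ultimately show ?thesis by (simp add: inner_right_distrib)
qed

lemma integral_adjoint_norm:
  fixes v :: "real \<Rightarrow> real ^ 'd"
  assumes t: "0 \<le> t" and v: "\<And>s. (v has_vector_derivative - (transpose P *v v s)) (at s)"
    and lyapunov: "P ** S + S ** transpose P = D ** transpose D"
  shows "integral {0..t} (\<lambda>s. (norm (transpose D *v v (t - s)))\<^sup>2) = v 0 \<bullet> (S *v v 0) - v t \<bullet> (S *v v t)"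
proof -
  have vd: "((\<lambda>s. v (t - s)) has_vector_derivative (transpose P *v v (t - s))) (at s within {0..t})" for s
  using has_vector_derivative_reflect[OF v, of t] by simp
  have "((\<lambda>s. v (t - s) \<bullet> (S *v v (t - s))) has_vector_derivative (norm (transpose D *v v (t - s)))\<^sup>2) (at s within {0..t})" for s
  proof -
    let ?a = "v (t - s)"
    \<comment> \<open>The product rule gives these two terms; moving P across the inner product
      turns them into the two summands of the Lyapunov equation.\<close>
    have "?a \<bullet> (S *v (transpose P *v ?a)) + (transpose P *v ?a) \<bullet> (S *v ?a) = ?a \<bullet> ((P ** S + S ** transpose P) *v ?a)"
      by (simp add: matrix_vector_mult_add_rdistrib inner_right_distrib matrix_vector_mul_assoc[symmetric] inner_matrix_vector[of _ P])
    also have "\<dots> = (norm (transpose D *v ?a))\<^sup>2"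
      by (simp add: lyapunov power2_norm_eq_inner matrix_vector_mul_assoc[symmetric] inner_matrix_vector[of _ D])
    finally show ?thesis
      using bounded_bilinear.has_vector_derivative[OF bounded_bilinear_inner vd[of s]
          bounded_linear.has_vector_derivative[OF matrix_vector_mul_bounded_linear vd[of s]], of S] by simp
  qed
  then have "((\<lambda>s. (norm (transpose D *v v (t - s)))\<^sup>2) has_integral
      v (t - t) \<bullet> (S *v v (t - t)) - v (t - 0) \<bullet> (S *v v (t - 0))) {0..t}"
    by (intro fundamental_theorem_of_calculus[OF t])
  then show ?thesis by (simp add: integral_unique)
qed

text \<open>For any continuous path the weighted increment sums converge to the noise term in
  \<open>variation_of_constants\<close>: after Abel summation only the smooth weight is
  differenced.\<close>

lemma wiener_sum_limit:
  fixes x v :: "real \<Rightarrow> real ^ 'd"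
  assumes t: "0 < t" and x: "continuous_on {0..t} x" and x0: "x 0 = 0"
    and v: "\<And>s. (v has_vector_derivative - (transpose P *v v s)) (at s)"
  shows "(\<lambda>n. \<Sum>k<Suc n. (transpose D *v v (t - grid t n k)) \<bullet> (x (grid t n (Suc k)) - x (grid t n k)))
     \<longlonglongrightarrow> v 0 \<bullet> (D *v x t) - integral {0..t} (\<lambda>s. (transpose P *v v (t - s)) \<bullet> (D *v x s))"
proof -
  define w where "w s = transpose D *v v (t - s)" for s
  define c where "c s = transpose D *v (transpose P *v v (t - s))" for s
  have "continuous_on UNIV v"
    using v by (meson continuous_at_imp_continuous_on has_vector_derivative_continuous)
  then have cv: "continuous_on UNIV (\<lambda>s. v (t - s))"
    by (rule continuous_on_compose2) (auto intro!: continuous_intros)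
  have cc: "continuous_on UNIV c" unfolding c_def
    by (intro continuous_on_compose2[OF matrix_vector_mult_linear_continuous_on] cv) auto
  have wd: "(w has_vector_derivative c s) (at s within T)" for s T
  proof -
    have "((\<lambda>s. v (t - s)) has_vector_derivative transpose P *v v (t - s)) (at s within T)"
      using has_vector_derivative_reflect[OF v, of t] by simp
    then show ?thesis unfolding w_def c_def
      using bounded_linear.has_vector_derivative[OF matrix_vector_mul_bounded_linear, of _ _ _ "transpose D"] by fastforce
  qed
  \<comment> \<open>On a cell the difference of weights is the integral of the derivative c, so the
    Abel remainder becomes a sum as in \<open>riemann_sum_limit\<close>.\<close>
  have step: "(w b - w a) \<bullet> q = integral {a..b} (\<lambda>s. c s \<bullet> q)" if "a \<le> b" for a b q
  proof -
    have "((\<lambda>s. w s \<bullet> q) has_vector_derivative c s \<bullet> q) (at s within {a..b})" for s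
      by (rule bounded_linear.has_vector_derivative[OF bounded_linear_inner_left wd])
    then have "((\<lambda>s. c s \<bullet> q) has_integral w b \<bullet> q - w a \<bullet> q) {a..b}"
      by (intro fundamental_theorem_of_calculus[OF that])
    then show ?thesis by (simp add: integral_unique inner_diff_left)
  qed
  have "(\<Sum>k<Suc n. w (grid t n k) \<bullet> (x (grid t n (Suc k)) - x (grid t n k)))
      = v 0 \<bullet> (D *v x t) - (\<Sum>k<Suc n. integral {grid t n k..grid t n (Suc k)} (\<lambda>s. c s \<bullet> x (grid t n (Suc k))))" for n
  proof -
    have "(\<Sum>k<Suc n. w (grid t n k) \<bullet> (x (grid t n (Suc k)) - x (grid t n k)))
        = w t \<bullet> x t - (\<Sum>k<Suc n. (w (grid t n (Suc k)) - w (grid t n k)) \<bullet> x (grid t n (Suc k)))"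
      using abel_summation_inner[of "\<lambda>k. w (grid t n k)" "\<lambda>k. x (grid t n k)" "Suc n"]
      by (simp only: grid_0[OF t] grid_last[OF t] x0) simp
    also have "w t \<bullet> x t = v 0 \<bullet> (D *v x t)" by (simp add: w_def inner_matrix_vector)
    finally show ?thesis by (simp only: step[OF less_imp_le[OF grid_less[OF t]]])
  qed
  moreover have "(\<lambda>n. \<Sum>k<Suc n. integral {grid t n k..grid t n (Suc k)} (\<lambda>s. c s \<bullet> x (grid t n (Suc k))))
      \<longlonglongrightarrow> integral {0..t} (\<lambda>s. c s \<bullet> x s)"
  proof (rule riemann_sum_limit[OF t])
    have "continuous_on ({0..t} \<times> {0..t}) (\<lambda>p. c (fst p) \<bullet> x (snd p))"
      by (intro continuous_intros continuous_on_compose2[OF cc] continuous_on_compose2[OF x]) auto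
    then show "continuous_on ({0..t} \<times> {0..t}) (\<lambda>(s, r). c s \<bullet> x r)"
      by (simp add: case_prod_unfold)
  qed (use grid_less[OF t] in \<open>auto intro: less_imp_le\<close>)
  ultimately have "(\<lambda>n. \<Sum>k<Suc n. w (grid t n k) \<bullet> (x (grid t n (Suc k)) - x (grid t n k)))
      \<longlonglongrightarrow> v 0 \<bullet> (D *v x t) - integral {0..t} (\<lambda>s. c s \<bullet> x s)"
    by (simp only:) (rule tendsto_diff[OF tendsto_const])
  then show ?thesis by (simp only: w_def c_def inner_matrix_vector[of _ D])
qed

section \<open>Law of the solution and its limit in distribution\<close>

context brownian_filtration
begin

text \<open>The increment sums converge almost surely to
  \<open>v 0 \<bullet> Y t - v t \<bullet> Y 0\<close>, so their characteristic functions converge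
  by dominated convergence. These are explicit, with variances that are Riemann sums for
  \<open>integral_adjoint_norm\<close>, and the two limits must agree.\<close>

lemma expectation_iexp_noise:
  fixes Y :: "real \<Rightarrow> 'w \<Rightarrow> real ^ 'd" and P D S :: "real ^ 'd ^ 'd" and v :: "real \<Rightarrow> real ^ 'd"
  assumes sde: "solves_linear_sde M F P D W Y" and t: "0 < t"
    and v: "\<And>s. (v has_vector_derivative - (transpose P *v v s)) (at s)"
    and lyapunov: "P ** S + S ** transpose P = D ** transpose D"
  shows "(\<integral>\<omega>. iexp (v 0 \<bullet> Y t \<omega> - v t \<bullet> Y 0 \<omega>) \<partial>M)
       = complex_of_real (exp (- (v 0 \<bullet> (S *v v 0) - v t \<bullet> (S *v v t)) / 2))"
proof -
  define w where "w s = transpose D *v v (t - s)" for s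
  define N where "N \<omega> = v 0 \<bullet> Y t \<omega> - v t \<bullet> Y 0 \<omega>" for \<omega>
  define Z where "Z n \<omega> = (\<Sum>k<Suc n. w (grid t n k) \<bullet> (W (grid t n (Suc k)) \<omega> - W (grid t n k) \<omega>))" for n \<omega>
  have Y_M: "Y s \<in> borel_measurable M" if "0 \<le> s" for s
    using measurable_from_subalg[OF subalgebra_F[OF that]] sde that
    by (auto simp: solves_linear_sde_def adapted_process_def)
  have [measurable]: "Y t \<in> borel_measurable M" "Y 0 \<in> borel_measurable M"
    using t by (auto intro: Y_M)
  have [measurable]: "N \<in> borel_measurable M" unfolding N_def by measurable
  have [measurable]: "W (grid t n k) \<in> borel_measurable M" for n k
    by (rule W_measurable[OF grid_nonneg[OF t]])
  have [measurable]: "Z n \<in> borel_measurable M" for n unfolding Z_def by measurable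
  have "AE \<omega> in M. continuous_on {0..} (\<lambda>t. W t \<omega>)"
    using brownian by (simp add: standard_brownian_motion_def)
  moreover have "AE \<omega> in M. continuous_on {0..} (\<lambda>t. Y t \<omega>)"
    and "AE \<omega> in M. \<forall>t\<ge>0. Y t \<omega> = Y 0 \<omega> - integral {0..t} (\<lambda>s. P *v Y s \<omega>) + D *v (W t \<omega> - W 0 \<omega>)"
    using sde by (auto simp: solves_linear_sde_def)
  ultimately have ZN: "AE \<omega> in M. (\<lambda>n. Z n \<omega>) \<longlonglongrightarrow> N \<omega>"
  proof eventually_elim
    case (elim \<omega>)
    \<comment> \<open>Subtracting \<open>W 0\<close> makes the path start exactly at 0, as
      \<open>wiener_sum_limit\<close> demands, and leaves all increments unchanged.\<close>
    let ?x = "\<lambda>s. W s \<omega> - W 0 \<omega>"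
    have x: "continuous_on {0..t} ?x"
      by (intro continuous_intros continuous_on_subset[OF elim(1)]) auto
    have y: "continuous_on {0..t} (\<lambda>s. Y s \<omega>)"
      by (rule continuous_on_subset[OF elim(2)]) auto
    have "v 0 \<bullet> Y t \<omega> = v t \<bullet> Y 0 \<omega> + (v 0 \<bullet> (D *v ?x t)
           - integral {0..t} (\<lambda>s. (transpose P *v v (t - s)) \<bullet> (D *v ?x s)))"
      by (rule variation_of_constants[OF less_imp_le[OF t] x y _ v]) (rule elim(3)[rule_format])
    moreover have "(\<lambda>n. Z n \<omega>) \<longlonglongrightarrow> v 0 \<bullet> (D *v ?x t)
           - integral {0..t} (\<lambda>s. (transpose P *v v (t - s)) \<bullet> (D *v ?x s))"
      using wiener_sum_limit[OF t x _ v, of D] by (simp add: Z_def w_def)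
    ultimately show ?case by (simp add: N_def)
  qed
  have "(\<lambda>n. \<integral>\<omega>. iexp (Z n \<omega>) \<partial>M) \<longlonglongrightarrow> (\<integral>\<omega>. iexp (N \<omega>) \<partial>M)"
  proof (rule integral_dominated_convergence[where w="\<lambda>_. 1"])
    show "AE \<omega> in M. (\<lambda>n. iexp (Z n \<omega>)) \<longlonglongrightarrow> iexp (N \<omega>)"
      using ZN by eventually_elim (intro tendsto_intros)
  qed auto
  moreover have "(\<lambda>n. \<integral>\<omega>. iexp (Z n \<omega>) \<partial>M) \<longlonglongrightarrow> complex_of_real (exp (- (v 0 \<bullet> (S *v v 0) - v t \<bullet> (S *v v t)) / 2))"
  proof -
    \<comment> \<open>Each variance term is written as the integral of a constant over its cell, to
      match \<open>riemann_sum_limit\<close> with left endpoints as tags.\<close>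
    have "(\<integral>\<omega>. iexp (Z n \<omega>) \<partial>M) = complex_of_real (exp (- (\<Sum>k<Suc n. integral {grid t n k..grid t n (Suc k)} (\<lambda>s. (norm (w (grid t n k)))\<^sup>2)) / 2))" for n
    proof -
      have "(\<integral>\<omega>. iexp (Z n \<omega>) \<partial>M) = complex_of_real (exp (- (\<Sum>k<Suc n. (norm (w (grid t n k)))\<^sup>2 * (grid t n (Suc k) - grid t n k)) / 2))"
        unfolding Z_def
        by (rule expectation_iexp_sum_increments) (use grid_less[OF t] grid_nonneg[OF t] in auto)
      then show ?thesis using grid_less[OF t] by (simp add: less_imp_le mult.commute)
    qed
    moreover have "(\<lambda>n. \<Sum>k<Suc n. integral {grid t n k..grid t n (Suc k)} (\<lambda>s. (norm (w (grid t n k)))\<^sup>2))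
      \<longlonglongrightarrow> integral {0..t} (\<lambda>s. (norm (w s))\<^sup>2)"
    proof (rule riemann_sum_limit[OF t])
      have "continuous_on UNIV v"
        using v by (meson continuous_at_imp_continuous_on has_vector_derivative_continuous)
      then have "continuous_on UNIV (\<lambda>s. v (t - s))"
        by (rule continuous_on_compose2) (auto intro!: continuous_intros)
      then have wc: "continuous_on UNIV w" unfolding w_def
        by (intro continuous_on_compose2[OF matrix_vector_mult_linear_continuous_on]) auto
      have "continuous_on ({0..t} \<times> {0..t}) (\<lambda>p. (norm (w (snd p)))\<^sup>2)"
        by (intro continuous_intros continuous_on_compose2[OF wc]) auto
      then show "continuous_on ({0..t} \<times> {0..t}) (\<lambda>(s, r). (norm (w r))\<^sup>2)"
        by (simp add: case_prod_unfold)
    qed (use grid_less[OF t] in \<open>auto intro: less_imp_le\<close>)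
    moreover have "integral {0..t} (\<lambda>s. (norm (w s))\<^sup>2) = v 0 \<bullet> (S *v v 0) - v t \<bullet> (S *v v t)"
      unfolding w_def by (rule integral_adjoint_norm[OF less_imp_le[OF t] v lyapunov])
    ultimately show ?thesis by (simp only:) (intro tendsto_intros, auto)
  qed
  ultimately show ?thesis unfolding N_def by (rule LIMSEQ_unique)
qed

text \<open>The initial value enters \<open>u \<bullet> Y t\<close> only through
  \<open>v t \<bullet> Y 0\<close>, which tends to 0 pointwise because v decays; the limit law is
  therefore the same for every initial law.\<close>

theorem linear_sde_converges_in_distribution:
  fixes Y :: "real \<Rightarrow> 'w \<Rightarrow> real ^ 'd" and P D R :: "real ^ 'd ^ 'd"
  assumes sde: "solves_linear_sde M F P D W Y"
    and lyapunov: "P ** (R ** transpose R) + (R ** transpose R) ** transpose P = D ** transpose D"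
    and adjoint: "\<And>u. \<exists>v. v 0 = u \<and> (\<forall>s. (v has_vector_derivative - (transpose P *v v s)) (at s)) \<and> (v \<longlongrightarrow> 0) at_top"
  shows "converges_in_distribution M Y (gaussian_law R) at_top"
  unfolding converges_in_distribution_def
proof (intro allI impI tendsto_at_topI_sequentially)
  fix f :: "real ^ 'd \<Rightarrow> real" and X :: "nat \<Rightarrow> real"
  assume f: "continuous_on UNIV f \<and> bounded (range f)" and X: "filterlim X at_top sequentially"
  \<comment> \<open>Times are raised to at least 1, since the noise formula is for positive times;
    eventually T agrees with X.\<close>
  define T where "T n = max 1 (X n)" for n
  have T1: "0 < T n" for n by (simp add: T_def)
  have TX: "eventually (\<lambda>n. T n = X n) sequentially"
    using filterlim_at_top[THEN iffD1, OF X, rule_format, of 1] by eventually_elim (simp add: T_def)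
  have Tlim: "filterlim T at_top sequentially"
    using filterlim_cong[OF refl refl TX] X by simp
  have Y_M: "Y s \<in> borel_measurable M" if "0 \<le> s" for s
    using measurable_from_subalg[OF subalgebra_F[OF that]] sde that
    by (auto simp: solves_linear_sde_def adapted_process_def)
  have [measurable]: "Y 0 \<in> borel_measurable M" "Y (T n) \<in> borel_measurable M" for n
    using T1[of n] by (auto intro: Y_M)
  let ?S = "R ** transpose R"
  let ?\<mu> = "\<lambda>n. distr M borel (Y (T n))"
  interpret levy_setting ?\<mu> "gaussian_law R"
  proof (rule levy_setting.intro)
    show "prob_space (?\<mu> n)" for n by (rule prob_space_distr) measurable
  qed (simp_all add: prob_space_gaussian_law)
  have char_lim: "(\<lambda>n. \<integral>x. iexp (u \<bullet> x) \<partial>?\<mu> n) \<longlonglongrightarrow> (\<integral>x. iexp (u \<bullet> x) \<partial>gaussian_law R)" for u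
  proof -
    obtain v where v: "v 0 = u" "\<And>s. (v has_vector_derivative - (transpose P *v v s)) (at s)" "(v \<longlongrightarrow> 0) at_top"
      using adjoint by blast
    have vT: "(\<lambda>n. v (T n)) \<longlonglongrightarrow> 0" by (rule filterlim_compose[OF v(3) Tlim])
    let ?E = "\<lambda>n \<omega>. iexp (u \<bullet> Y (T n) \<omega> - v (T n) \<bullet> Y 0 \<omega>)"
    have "(\<lambda>n. complex_of_real (exp (- (u \<bullet> (?S *v u) - v (T n) \<bullet> (?S *v v (T n))) / 2)))
        \<longlonglongrightarrow> complex_of_real (exp (- (u \<bullet> (?S *v u) - 0 \<bullet> (?S *v 0)) / 2))"
      by (intro tendsto_intros vT bounded_linear.tendsto[OF matrix_vector_mul_bounded_linear]) auto
    then have 1: "(\<lambda>n. \<integral>\<omega>. ?E n \<omega> \<partial>M) \<longlonglongrightarrow> (\<integral>x. iexp (u \<bullet> x) \<partial>gaussian_law R)"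
      using expectation_iexp_noise[OF sde T1 v(2) lyapunov] by (simp add: v(1) iexp_gaussian_law)
    \<comment> \<open>This integral is the difference between the characteristic function of
      \<open>Y (T n)\<close> at u and that of its noise part; the integrand tends to 0 and is
      bounded by 2.\<close>
    have "(\<lambda>n. \<integral>\<omega>. ?E n \<omega> * (iexp (v (T n) \<bullet> Y 0 \<omega>) - 1) \<partial>M) \<longlonglongrightarrow> (\<integral>\<omega>. 0 \<partial>M)"
    proof (rule integral_dominated_convergence[where w="\<lambda>_. 2"])
      show "AE \<omega> in M. (\<lambda>n. ?E n \<omega> * (iexp (v (T n) \<bullet> Y 0 \<omega>) - 1)) \<longlonglongrightarrow> 0"
      proof (rule AE_I2)
        fix \<omega>
        have "(\<lambda>n. iexp (v (T n) \<bullet> Y 0 \<omega>) - 1) \<longlonglongrightarrow> iexp (0 \<bullet> Y 0 \<omega>) - 1"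
          by (intro tendsto_intros vT)
        then have "(\<lambda>n. norm (iexp (v (T n) \<bullet> Y 0 \<omega>) - 1)) \<longlonglongrightarrow> 0"
          using tendsto_norm_zero by fastforce
        then show "(\<lambda>n. ?E n \<omega> * (iexp (v (T n) \<bullet> Y 0 \<omega>) - 1)) \<longlonglongrightarrow> 0"
          by (intro tendsto_norm_zero_cancel[where f="\<lambda>n. ?E n \<omega> * (iexp (v (T n) \<bullet> Y 0 \<omega>) - 1)"])
             (simp add: norm_mult)
      qed
      show "AE \<omega> in M. norm (?E n \<omega> * (iexp (v (T n) \<bullet> Y 0 \<omega>) - 1)) \<le> 2" for n
        using norm_triangle_ineq4[of "iexp (v (T n) \<bullet> Y 0 _)" 1] by (auto simp: norm_mult)
    qed auto
    then have "(\<lambda>n. (\<integral>\<omega>. ?E n \<omega> \<partial>M) + (\<integral>\<omega>. ?E n \<omega> * (iexp (v (T n) \<bullet> Y 0 \<omega>) - 1) \<partial>M))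
       \<longlonglongrightarrow> (\<integral>x. iexp (u \<bullet> x) \<partial>gaussian_law R) + 0"
      using 1 by (intro tendsto_add) auto
    moreover have "(\<integral>\<omega>. ?E n \<omega> \<partial>M) + (\<integral>\<omega>. ?E n \<omega> * (iexp (v (T n) \<bullet> Y 0 \<omega>) - 1) \<partial>M)
        = (\<integral>x. iexp (u \<bullet> x) \<partial>?\<mu> n)" for n
    proof -
      have int: "integrable M (\<lambda>\<omega>. iexp (g \<omega>))" if "g \<in> borel_measurable M" for g :: "'w \<Rightarrow> real"
        using that by (intro integrable_const_bound[where B=1]) auto
      have eq: "?E n \<omega> * (iexp (v (T n) \<bullet> Y 0 \<omega>) - 1) = iexp (u \<bullet> Y (T n) \<omega>) - ?E n \<omega>" for \<omega>
        by (simp add: right_diff_distrib exp_add[symmetric] del: of_real_diff) (simp add: algebra_simps)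
      have "(\<integral>\<omega>. ?E n \<omega> * (iexp (v (T n) \<bullet> Y 0 \<omega>) - 1) \<partial>M) = (\<integral>\<omega>. iexp (u \<bullet> Y (T n) \<omega>) \<partial>M) - (\<integral>\<omega>. ?E n \<omega> \<partial>M)"
        unfolding eq by (intro Bochner_Integration.integral_diff int) measurable
      moreover have "(\<integral>x. iexp (u \<bullet> x) \<partial>?\<mu> n) = (\<integral>\<omega>. iexp (u \<bullet> Y (T n) \<omega>) \<partial>M)"
        by (rule integral_distr) measurable
      ultimately show ?thesis by simp
    qed
    ultimately show ?thesis by simp
  qed
  have cos_eq: "(\<integral>x. cos (u \<bullet> x + a) \<partial>\<nu>) = Re (iexp a * (\<integral>x. iexp (u \<bullet> x) \<partial>\<nu>))"
    if "prob_space \<nu>" "sets \<nu> = sets borel" for u :: "real ^ 'd" and a \<nu>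
  proof -
    interpret \<nu>: prob_space \<nu> by fact
    note [measurable_cong] = that(2)
    have int: "integrable \<nu> (\<lambda>x. iexp (u \<bullet> x))"
      by (intro \<nu>.integrable_const_bound[where B=1]) auto
    have "Re (iexp a * (\<integral>x. iexp (u \<bullet> x) \<partial>\<nu>)) = Re (\<integral>x. iexp a * iexp (u \<bullet> x) \<partial>\<nu>)"
      by simp
    also have "\<dots> = (\<integral>x. Re (iexp a * iexp (u \<bullet> x)) \<partial>\<nu>)"
      using int by (intro integral_Re[symmetric]) auto
    also have "\<dots> = (\<integral>x. cos (u \<bullet> x + a) \<partial>\<nu>)"
      by (simp add: exp_add[symmetric] distrib_left[symmetric] Re_exp add.commute del: times_complex.sel)
    finally show ?thesis by simp
  qed
  have "(\<lambda>n. \<integral>x. f x \<partial>?\<mu> n) \<longlonglongrightarrow> (\<integral>x. f x \<partial>gaussian_law R)"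
  proof (rule levy_continuity_euclidean)
    show "(\<lambda>n. \<integral>x. cos (u \<bullet> x + a) \<partial>?\<mu> n) \<longlonglongrightarrow> (\<integral>x. cos (u \<bullet> x + a) \<partial>gaussian_law R)" for u a
      unfolding cos_eq[OF prob_mu sets_mu] cos_eq[OF prob_L sets_L]
      by (intro tendsto_intros char_lim)
  qed (use f in auto)
  moreover have "eventually (\<lambda>n. (\<integral>x. f x \<partial>?\<mu> n) = (\<integral>x. f x \<partial>distr M borel (Y (X n)))) sequentially"
    using TX by eventually_elim simp
  ultimately show "(\<lambda>n. \<integral>x. f x \<partial>distr M borel (Y (X n))) \<longlonglongrightarrow> (\<integral>x. f x \<partial>gaussian_law R)"
    by (rule Lim_transform_eventually)
qed

end

section \<open>The symmetric circle network\<close>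

lemma sum_UNIV_sum: "(\<Sum>x\<in>UNIV. f x) = (\<Sum>i\<in>UNIV. f (Inl i)) + (\<Sum>i\<in>UNIV. f (Inr i))"
  for f :: "'a::finite + 'b::finite \<Rightarrow> 'c::comm_monoid_add"
  unfolding UNIV_Plus_UNIV[symmetric] by (subst sum.Plus) (auto simp: o_def)

text \<open>The block matrix with blocks \<open>a I + b J\<close>, \<open>c J\<close>, \<open>d J\<close>, \<open>e I + f J\<close>, where \<open>J\<close> is the
  all-ones matrix.\<close>

definition block_mat :: "real \<Rightarrow> real \<Rightarrow> real \<Rightarrow> real \<Rightarrow> real \<Rightarrow> real \<Rightarrow> real ^ ('n + 'n) ^ ('n::finite + 'n)" where
  "block_mat a b c d e f = (\<chi> k l. case k of
     Inl i \<Rightarrow> (case l of Inl j \<Rightarrow> (if i = j then a else 0) + b | Inr j \<Rightarrow> c)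
   | Inr i \<Rightarrow> (case l of Inl j \<Rightarrow> d | Inr j \<Rightarrow> (if i = j then e else 0) + f))"

lemma block_mat_nth [simp]:
  "block_mat a b c d e f $ Inl i $ Inl j = (if i = j then a else 0) + b"
  "block_mat a b c d e f $ Inl i $ Inr j = c"
  "block_mat a b c d e f $ Inr i $ Inl j = d"
  "block_mat a b c d e f $ Inr i $ Inr j = (if i = j then e else 0) + f"
  by (simp_all add: block_mat_def)

lemma block_mat_eqI:
  fixes A B :: "real ^ ('n + 'n) ^ ('n::finite + 'n)"
  assumes "\<And>i j. A $ Inl i $ Inl j = B $ Inl i $ Inl j" "\<And>i j. A $ Inl i $ Inr j = B $ Inl i $ Inr j"
    "\<And>i j. A $ Inr i $ Inl j = B $ Inr i $ Inl j" "\<And>i j. A $ Inr i $ Inr j = B $ Inr i $ Inr j"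
  shows "A = B"
  unfolding vec_eq_iff
proof (intro allI)
  show "A $ k $ l = B $ k $ l" for k l
    using assms by (cases k; cases l) simp_all
qed

lemma block_mat_cong:
  "a = a' \<Longrightarrow> b = b' \<Longrightarrow> c = c' \<Longrightarrow> d = d' \<Longrightarrow> e = e' \<Longrightarrow> f = f' \<Longrightarrow>
     block_mat a b c d e f = block_mat a' b' c' d' e' f'"
  by simp

lemma transpose_block_mat: "transpose (block_mat a b c d e f) = block_mat a b d c e f"
  by (rule block_mat_eqI) (auto simp: transpose_def)

lemma block_mat_add:
  "block_mat a b c d e f + block_mat a' b' c' d' e' f' =
     block_mat (a + a') (b + b') (c + c') (d + d') (e + e') (f + f')"
  by (rule block_mat_eqI) auto

lemma sum_delta_affine_mult:
  fixes a b a' b' :: real and i j :: "'n::finite"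
  shows "(\<Sum>k\<in>UNIV. ((if i = k then a else 0) + b) * ((if k = j then a' else 0) + b')) =
    (if i = j then a * a' else 0) + (a * b' + b * a' + real CARD('n) * (b * b'))"
  by (simp add: distrib_left distrib_right sum.distrib if_distrib[of "\<lambda>x. x * _"] if_distrib[of "\<lambda>x. _ * x"] cong: if_cong)

lemma sum_delta_affine:
  fixes a b :: real and i :: "'n::finite"
  shows "(\<Sum>k\<in>UNIV. (if i = k then a else 0) + b) = a + real CARD('n) * b"
    "(\<Sum>k\<in>UNIV. (if k = i then a else 0) + b) = a + real CARD('n) * b"
  by (simp_all add: sum.distrib)

text \<open>The family is closed under products because J J = N J, which is where the factors N come
  from.\<close>

lemma block_mat_mult:
  fixes a b c d e f a' b' c' d' e' f' :: real
  defines "N \<equiv> real CARD('n::finite)"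
  shows "(block_mat a b c d e f :: real ^ ('n + 'n) ^ ('n + 'n)) ** block_mat a' b' c' d' e' f' =
     block_mat (a * a') (a * b' + b * a' + N * (b * b') + N * (c * d'))
       (a * c' + N * (b * c') + c * e' + N * (c * f')) (d * a' + N * (d * b') + e * d' + N * (f * d'))
       (e * e') (e * f' + f * e' + N * (f * f') + N * (d * c'))"
  by (rule block_mat_eqI)
     (simp_all add: matrix_matrix_mult_def sum_UNIV_sum sum_delta_affine_mult sum_delta_affine
        sum_distrib_left[symmetric] sum_distrib_right[symmetric] N_def, simp_all add: algebra_simps)

lemma block_mat_vector:
  "(block_mat a b c d e f *v x) $ Inl i = a * x $ Inl i + b * (\<Sum>j\<in>UNIV. x $ Inl j) + c * (\<Sum>j\<in>UNIV. x $ Inr j)"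
  "(block_mat a b c d e f *v x) $ Inr i = d * (\<Sum>j\<in>UNIV. x $ Inl j) + e * x $ Inr i + f * (\<Sum>j\<in>UNIV. x $ Inr j)"
  by (simp_all add: matrix_vector_mult_def sum_UNIV_sum distrib_right sum.distrib sum_distrib_left
      if_distrib[of "\<lambda>x. x * _"] cong: if_cong)

text \<open>Expanding \<open>1 - \<rho> / (N * C)\<close> on the diagonal of A leaves a - b, where a
  is the first argument of \<open>block_mat\<close>. Hence A = a I - b J, while B = - b J with the
  same b.\<close>

lemma P_mat_eq_block:
  fixes \<mu> \<kappa> \<eta> C \<rho> :: real
  assumes "C \<noteq> 0"
  defines "b \<equiv> \<mu> * (\<rho> * (C - \<rho>) / (real CARD('n::finite) * C * (\<kappa> / \<eta>)))"
  shows "(P_mat \<mu> \<kappa> \<eta> C \<rho> :: real ^ ('n + 'n) ^ ('n + 'n)) =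
    block_mat (\<mu> * ((C - \<rho>) / (\<kappa> / \<eta>))) (- b) (- b) 0 \<eta> 0"
  by (rule block_mat_eqI)
     (auto simp: P_mat_def A_mat_def B_mat_def E_mat_def mat_def b_def divide_inverse algebra_simps)

lemma D_mat_eq_block: "D_mat lam \<kappa> = block_mat (sqrt (2 * lam)) 0 0 0 (sqrt (2 * \<kappa>)) 0"
  by (rule block_mat_eqI) (auto simp: D_mat_def)

text \<open>Comparing coefficients of I and J in each block: the I parts of the diagonal blocks give
  \<open>a * s = lam\<close> and \<open>\<eta> * h = \<kappa>\<close>, the J part of the first block
  gives the equation for c, and the off-diagonal blocks give the one for g.\<close>

lemma block_mat_lyapunov:
  fixes a b c g h s \<eta> lam \<kappa> :: real
  defines "N \<equiv> real CARD('n::finite)"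
  defines "S \<equiv> block_mat s c g g h 0 :: real ^ ('n + 'n) ^ ('n + 'n)"
  assumes "0 \<le> lam" "0 \<le> \<kappa>" "a * s = lam" "\<eta> * h = \<kappa>"
    and "a * c - b * s - N * b * c - N * b * g = 0" "(a - N * b + \<eta>) * g = b * h"
  shows "block_mat a (- b) (- b) 0 \<eta> 0 ** S + S ** transpose (block_mat a (- b) (- b) 0 \<eta> 0)
     = D_mat lam \<kappa> ** transpose (D_mat lam \<kappa>)"
  unfolding S_def D_mat_eq_block transpose_block_mat block_mat_mult block_mat_add N_def[symmetric]
  using assms(3-) by (intro block_mat_cong) (auto simp: algebra_simps)

section \<open>Decay of the adjoint flow\<close>

lemma exp_minus_tendsto_0: "0 < (a::real) \<Longrightarrow> ((\<lambda>s. exp (- (a * s))) \<longlongrightarrow> 0) at_top"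
  by (intro filterlim_compose[OF exp_at_bot] filterlim_compose[OF filterlim_uminus_at_bot_at_top]
      filterlim_tendsto_pos_mult_at_top[OF tendsto_const] filterlim_ident)

text \<open>The response of a mode of rate \<open>\<eta>\<close> to a decaying input of rate
  \<open>\<alpha>\<close>. Equal rates are the resonant case, where the difference of exponentials
  is replaced by s times an exponential.\<close>

lemma relaxation_solution:
  fixes \<alpha> \<eta> :: real
  assumes "0 < \<alpha>" "0 < \<eta>"
  obtains \<phi> where "\<phi> 0 = 0" "\<And>s. (\<phi> has_real_derivative exp (- (\<alpha> * s)) - \<eta> * \<phi> s) (at s)" "(\<phi> \<longlongrightarrow> 0) at_top"
proof (cases "\<eta> = \<alpha>")
  case True
  show ?thesis
  proof (rule that[of "\<lambda>s. s * exp (- (\<alpha> * s))"])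
    show "((\<lambda>s. s * exp (- (\<alpha> * s))) has_real_derivative exp (- (\<alpha> * s)) - \<eta> * (s * exp (- (\<alpha> * s)))) (at s)" for s
      by (auto intro!: derivative_eq_intros simp: True)
    have "((\<lambda>s. (\<alpha> * s) ^ 1 / exp (\<alpha> * s)) \<longlongrightarrow> 0) at_top"
      by (intro filterlim_compose[OF tendsto_power_div_exp_0] filterlim_tendsto_pos_mult_at_top[OF tendsto_const] filterlim_ident assms)
    then have "((\<lambda>s. (\<alpha> * s) ^ 1 / exp (\<alpha> * s) / \<alpha>) \<longlongrightarrow> 0 / \<alpha>) at_top"
      by (intro tendsto_divide tendsto_const) (use assms in auto)
    then show "((\<lambda>s. s * exp (- (\<alpha> * s))) \<longlongrightarrow> 0) at_top"
      using assms by (simp add: exp_minus field_simps)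
  qed simp
next
  case False
  show ?thesis
  proof (rule that[of "\<lambda>s. (exp (- (\<alpha> * s)) - exp (- (\<eta> * s))) / (\<eta> - \<alpha>)"])
    show "((\<lambda>s. (exp (- (\<alpha> * s)) - exp (- (\<eta> * s))) / (\<eta> - \<alpha>)) has_real_derivative
        exp (- (\<alpha> * s)) - \<eta> * ((exp (- (\<alpha> * s)) - exp (- (\<eta> * s))) / (\<eta> - \<alpha>))) (at s)" for s
    proof -
      have "((\<lambda>s. (exp (- (\<alpha> * s)) - exp (- (\<eta> * s))) / (\<eta> - \<alpha>)) has_real_derivative
          (\<eta> * exp (- (\<eta> * s)) - \<alpha> * exp (- (\<alpha> * s))) / (\<eta> - \<alpha>)) (at s)"
        using False by (auto intro!: derivative_eq_intros)
      moreover have "(\<eta> * B - \<alpha> * A) / (\<eta> - \<alpha>) = A - \<eta> * ((A - B) / (\<eta> - \<alpha>))" for A B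
        using False by (simp add: divide_simps) (simp add: algebra_simps)
      ultimately show ?thesis by simp
    qed
    have "((\<lambda>s. (exp (- (\<alpha> * s)) - exp (- (\<eta> * s))) / (\<eta> - \<alpha>)) \<longlongrightarrow> (0 - 0) / (\<eta> - \<alpha>)) at_top"
      using False by (intro tendsto_intros exp_minus_tendsto_0 assms) auto
    then show "((\<lambda>s. (exp (- (\<alpha> * s)) - exp (- (\<eta> * s))) / (\<eta> - \<alpha>)) \<longlongrightarrow> 0) at_top" by simp
  qed simp
qed

lemma has_vector_derivative_vecI:
  fixes v :: "real \<Rightarrow> real ^ 'd::finite"
  assumes "\<And>k. ((\<lambda>s. v s $ k) has_real_derivative v' $ k) (at s)"
  shows "(v has_vector_derivative v') (at s)"
proof -
  have "((\<lambda>s. v s \<bullet> b) has_derivative (\<lambda>y. (y *\<^sub>R v') \<bullet> b)) (at s)" if b: "b \<in> Basis" for b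
  proof -
    obtain k where "b = axis k 1" using b by (auto simp: Basis_vec_def)
    then show ?thesis
      using assms[of k] by (simp add: inner_axis has_field_derivative_def mult_commute_abs)
  qed
  then show ?thesis
    unfolding has_vector_derivative_def by (subst has_derivative_componentwise_within) auto
qed

text \<open>The adjoint flow decouples into the deviations of the first block from their mean (rate \<open>a\<close>), that
  mean (rate \<open>a - N b\<close>), and the second block (rate \<open>\<eta>\<close>) driven by the mean.\<close>

lemma block_mat_adjoint_solution:
  fixes a b \<eta> :: real and u :: "real ^ ('n::finite + 'n)"
  assumes "0 < a" "0 < \<eta>" and pos: "0 < a - real CARD('n) * b"
  shows "\<exists>v. v 0 = u \<and> (\<forall>s. (v has_vector_derivative - (transpose (block_mat a (- b) (- b) 0 \<eta> 0) *v v s)) (at s))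
     \<and> (v \<longlongrightarrow> 0) at_top"
proof -
  define N where "N = real CARD('n)"
  have "0 < N" by (simp add: N_def)
  define p where "p = (\<Sum>j\<in>UNIV. u $ Inl j) / N"
  obtain \<phi> where \<phi>: "\<phi> 0 = 0" "\<And>s. (\<phi> has_real_derivative exp (- ((a - N * b) * s)) - \<eta> * \<phi> s) (at s)" "(\<phi> \<longlongrightarrow> 0) at_top"
    using relaxation_solution[of "a - N * b" \<eta>] assms by (auto simp: N_def)
  define v :: "real \<Rightarrow> real ^ ('n + 'n)" where "v s = (\<chi> k. case k of
      Inl i \<Rightarrow> exp (- (a * s)) * (u $ Inl i - p) + exp (- ((a - N * b) * s)) * p
    | Inr i \<Rightarrow> exp (- (\<eta> * s)) * u $ Inr i + N * b * p * \<phi> s)" for s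
  have v_nth: "v s $ Inl i = exp (- (a * s)) * (u $ Inl i - p) + exp (- ((a - N * b) * s)) * p"
    "v s $ Inr i = exp (- (\<eta> * s)) * u $ Inr i + N * b * p * \<phi> s" for s i
    by (simp_all add: v_def)
  \<comment> \<open>The deviations from the mean p sum to zero at all times, so the J terms see only
    the mean.\<close>
  have total: "(\<Sum>j\<in>UNIV. v s $ Inl j) = N * p * exp (- ((a - N * b) * s))" for s
  proof -
    have "(\<Sum>j\<in>UNIV. u $ Inl j - p) = 0"
      using \<open>0 < N\<close> by (simp add: sum_subtractf p_def N_def)
    then show ?thesis
      by (simp add: v_nth sum.distrib sum_distrib_left[symmetric] N_def)
  qed
  have "v 0 = u"
    unfolding vec_eq_iff by (auto simp: v_def \<phi>(1) split: sum.split)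
  moreover have "(v has_vector_derivative - (transpose (block_mat a (- b) (- b) 0 \<eta> 0) *v v s)) (at s)" for s
  proof (rule has_vector_derivative_vecI)
    fix k :: "'n + 'n"
    show "((\<lambda>s. v s $ k) has_real_derivative (- (transpose (block_mat a (- b) (- b) 0 \<eta> 0) *v v s)) $ k) (at s)"
    proof (cases k)
      case (Inl i)
      show ?thesis
        unfolding Inl transpose_block_mat vector_uminus_component block_mat_vector total
        unfolding v_nth by (auto intro!: derivative_eq_intros simp: algebra_simps)
    next
      case (Inr i)
      show ?thesis
        unfolding Inr transpose_block_mat vector_uminus_component block_mat_vector total
        unfolding v_nth by (auto intro!: derivative_eq_intros \<phi>(2) simp: algebra_simps)
    qed
  qed
  moreover have "(v \<longlongrightarrow> 0) at_top"
  proof (rule vec_tendstoI)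
    fix k :: "'n + 'n"
    show "((\<lambda>s. v s $ k) \<longlongrightarrow> 0 $ k) at_top"
    proof (cases k)
      case (Inl i)
      have "((\<lambda>s. v s $ k) \<longlongrightarrow> 0 * (u $ Inl i - p) + 0 * p) at_top"
        unfolding Inl v_nth using assms by (intro tendsto_intros exp_minus_tendsto_0) (auto simp: N_def)
      then show ?thesis by simp
    next
      case (Inr i)
      have "((\<lambda>s. v s $ k) \<longlongrightarrow> 0 * u $ Inr i + N * b * p * 0) at_top"
        unfolding Inr v_nth using assms by (intro tendsto_intros exp_minus_tendsto_0 \<phi>(3))
      then show ?thesis by simp
    qed
  qed
  ultimately show ?thesis by blast
qed

section \<open>Square root and entries of the covariance matrix\<close>

text \<open>A block Cholesky factorisation with R upper block triangular. The off-diagonal block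
  contributes \<open>N * g\<^sup>2 / h\<close> times J to the first block; what is left is the Schur
  complement s I + c' J with c' nonnegative, whose root is again of the form x I + q J.\<close>

lemma block_mat_square_root:
  fixes s c g h :: real
  defines "N \<equiv> real CARD('n::finite)"
  assumes "0 \<le> s" "0 < h" and schur: "N * g\<^sup>2 / h \<le> c"
   obtains R :: "real ^ ('n::finite + 'n) ^ ('n + 'n)" where "R ** transpose R = block_mat s c g g h 0"
proof
  define c' where "c' = c - N * g\<^sup>2 / h"
  \<comment> \<open>The eigenvalue of that root on constant vectors; q is then determined by
    \<open>sqrt s + N * q = r\<close>.\<close>
  define r where "r = sqrt (s + N * c')"
  define q where "q = (r - sqrt s) / N"
  have "0 < N" by (simp add: N_def)
  have "0 \<le> c'" using schur by (simp add: c'_def)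
  have Nq: "N * q = r - sqrt s" using \<open>0 < N\<close> by (simp add: q_def)
  have "N * (2 * sqrt s * q + N * q\<^sup>2) = (N * q + sqrt s)\<^sup>2 - (sqrt s)\<^sup>2"
    by (simp add: power2_eq_square algebra_simps)
  also have "\<dots> = N * c'"
    using \<open>0 \<le> s\<close> \<open>0 < N\<close> \<open>0 \<le> c'\<close> by (simp add: Nq r_def)
  finally have q: "2 * sqrt s * q + N * q\<^sup>2 = c'" using \<open>0 < N\<close> by simp
  have g: "N * (g / sqrt h * (g / sqrt h)) = N * g\<^sup>2 / h" "g / sqrt h * sqrt h = g" "sqrt h * (g / sqrt h) = g"
    using \<open>0 < h\<close> by (simp_all add: power2_eq_square)
  show "block_mat (sqrt s) q (g / sqrt h) 0 (sqrt h) 0 ** transpose (block_mat (sqrt s) q (g / sqrt h) 0 (sqrt h) 0)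
      = (block_mat s c g g h 0 :: real ^ ('n + 'n) ^ ('n + 'n))"
    unfolding transpose_block_mat block_mat_mult N_def[symmetric]
    using q \<open>0 \<le> s\<close> \<open>0 < h\<close>
    by (intro block_mat_cong) (simp_all add: g c'_def power2_eq_square algebra_simps)
qed

text \<open>With \<open>\<rho>\<close>, e = C - \<open>\<rho>\<close> and h =
  \<open>\<kappa> / \<eta>\<close> as free positive parameters the constraint
  \<open>\<rho> < C\<close> disappears. The denominator K arises as
  \<open>(a - N * b + \<eta>) * h * C\<close>, so g is the solution of the off-diagonal equation,
  and c is then forced by the remaining one.\<close>

lemma circle_network_covariance:
  fixes N \<mu> \<eta> h \<rho> e :: real
  assumes pos: "0 < N" "0 < \<mu>" "0 < \<eta>" "0 < h" "0 < \<rho>" "0 < e"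
  defines "C \<equiv> \<rho> + e" and "K \<equiv> \<mu> * e\<^sup>2 + (\<rho> + e) * (\<eta> * h)"
  defines "a \<equiv> \<mu> * (e / h)" and "b \<equiv> \<mu> * (\<rho> * e / (N * C * h))" and "s \<equiv> h * (\<rho> / e)"
    and "g \<equiv> 1 / N * h * (\<mu> * \<rho> * e / K)" and "c \<equiv> 1 / N * h * (\<rho>\<^sup>2 / e\<^sup>2 + \<mu> * \<rho> * \<rho> / K)"
  shows "0 < a - N * b"
    and "a * c - b * s - N * b * c - N * b * g = 0"
    and "(a - N * b + \<eta>) * g = b * h"
    and "N * g\<^sup>2 / h \<le> c"
proof -
  have C: "0 < C" and K: "0 < K" and KC: "K = \<mu> * e\<^sup>2 + C * (\<eta> * h)"
    using pos by (auto simp: C_def K_def intro!: add_pos_pos)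
  have aNb: "a - N * b = \<mu> * e\<^sup>2 / (h * C)"
  proof -
    have "a - N * b = \<mu> * e * (C - \<rho>) / (h * C)"
      using pos C by (simp add: a_def b_def field_simps)
    then show ?thesis by (simp add: C_def power2_eq_square)
  qed
  then show "0 < a - N * b" using pos C by simp
  have "(a - N * b) * c = \<mu> / (C * N) * (\<rho>\<^sup>2 + \<mu> * \<rho>\<^sup>2 * e\<^sup>2 / K)"
    unfolding aNb c_def using pos C K by (simp add: divide_simps) (simp add: power2_eq_square algebra_simps)
  moreover have "b * s = \<mu> * \<rho>\<^sup>2 / (C * N)"
    unfolding b_def s_def using pos C by (simp add: divide_simps power2_eq_square)
  moreover have "N * b * g = \<mu> / (C * N) * (\<mu> * \<rho>\<^sup>2 * e\<^sup>2 / K)"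
    unfolding b_def g_def using pos C K by (simp add: divide_simps power2_eq_square)
  ultimately show "a * c - b * s - N * b * c - N * b * g = 0"
    by (simp add: algebra_simps)
  have "a - N * b + \<eta> = K / (h * C)"
    unfolding aNb KC using pos C by (simp add: field_simps)
  then show "(a - N * b + \<eta>) * g = b * h"
    using pos C K by (simp add: g_def b_def field_simps)
  \<comment> \<open>The bound needs only \<open>\<mu> * e\<^sup>2 \<le> K\<close> and the second
    summand of c.\<close>
  have "N * g\<^sup>2 / h = 1 / N * h * (\<mu> * \<rho>\<^sup>2 / K * (\<mu> * e\<^sup>2 / K))"
    using pos K by (simp add: g_def power2_eq_square divide_simps)
  also have "\<dots> \<le> 1 / N * h * (\<mu> * \<rho>\<^sup>2 / K * 1)"
    using pos C K by (intro mult_left_mono) (auto simp: KC)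
  also have "\<dots> \<le> c"
    unfolding c_def using pos K by (intro mult_left_mono) (auto simp: power2_eq_square mult.assoc)
  finally show "N * g\<^sup>2 / h \<le> c" .
qed

theorem mainTheorem8:
  fixes lam \<mu> \<kappa> \<eta> C \<rho> :: real
    and M :: "'w measure" and F :: "real \<Rightarrow> 'w measure"
    and W Y :: "real \<Rightarrow> 'w \<Rightarrow> real ^ ('n::finite + 'n)"
  assumes "CARD('n) \<ge> 2"
    and "lam > 0" "\<mu> > 0" "\<kappa> > 0" "\<eta> > 0" "C > 0"
    and "\<rho> = lam / \<mu>" "\<rho> < C"
    and "prob_space M" "filtration_on M F"
    and "standard_brownian_motion M F W"
    and "solves_linear_sde M F (P_mat \<mu> \<kappa> \<eta> C \<rho>) (D_mat lam \<kappa>) W Y"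
  shows "\<exists>L :: (real ^ ('n + 'n)) measure.
    multivariate_normal L \<and>
    converges_in_distribution M Y L at_top \<and>
    (\<forall>k. (\<integral>x. x $ k \<partial>L) = 0) \<and>
    (\<forall>i j. i \<noteq> j \<longrightarrow>
       covariance L (\<lambda>x. x $ Inl i) (\<lambda>x. x $ Inl j) =
         1 / real CARD('n) * (\<kappa> / \<eta>) *
           (\<rho>\<^sup>2 / (C - \<rho>)\<^sup>2 + lam * \<rho> / (\<mu> * (C - \<rho>)\<^sup>2 + C * \<kappa>)) \<and>
       prob_space.variance L (\<lambda>x. x $ Inl i) =
         \<kappa> / \<eta> * (\<rho> / (C - \<rho>)) + covariance L (\<lambda>x. x $ Inl i) (\<lambda>x. x $ Inl j) \<and>
       covariance L (\<lambda>x. x $ Inr i) (\<lambda>x. x $ Inr j) = 0) \<and>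
    (\<forall>i. prob_space.variance L (\<lambda>x. x $ Inr i) = \<kappa> / \<eta>) \<and>
    (\<forall>i j. covariance L (\<lambda>x. x $ Inl i) (\<lambda>x. x $ Inr j) =
       1 / real CARD('n) * (\<kappa> / \<eta>) * (lam * (C - \<rho>) / (\<mu> * (C - \<rho>)\<^sup>2 + C * \<kappa>)))"
proof -
  define N h e K where "N = real CARD('n)" and "h = \<kappa> / \<eta>" and "e = C - \<rho>"
    and "K = \<mu> * e\<^sup>2 + C * \<kappa>"
  \<comment> \<open>The candidate covariance is \<open>block_mat s c g g h 0\<close>: c is the
    covariance of two distinct elastic coordinates, s the excess of their variance over it, g the
    elastic-streaming covariance and h the streaming variance.\<close>
  define a b s g c where "a = \<mu> * (e / h)" and "b = \<mu> * (\<rho> * e / (N * C * h))"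
    and "s = h * (\<rho> / e)" and "g = 1 / N * h * (lam * e / K)"
    and "c = 1 / N * h * (\<rho>\<^sup>2 / e\<^sup>2 + lam * \<rho> / K)"
  have pos: "0 < N" "0 < h" "0 < e" "0 < \<rho>" "0 < s"
    using assms(2-8) by (auto simp: N_def h_def e_def s_def)
  \<comment> \<open>Rewrites the data in the free parameters of
    \<open>circle_network_covariance\<close>.\<close>
  have subst: "C = \<rho> + e" "lam = \<mu> * \<rho>" "\<kappa> = \<eta> * h"
    using assms(2-8) by (auto simp: e_def h_def)
  have cov: "0 < a - N * b" "a * c - b * s - N * b * c - N * b * g = 0"
    "(a - N * b + \<eta>) * g = b * h" "N * g\<^sup>2 / h \<le> c"
    using circle_network_covariance[OF pos(1) assms(3) assms(5) pos(2) pos(4) pos(3)]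
    unfolding a_def b_def s_def g_def c_def K_def subst by auto
  let ?P = "P_mat \<mu> \<kappa> \<eta> C \<rho> :: real ^ ('n + 'n) ^ ('n + 'n)"
  let ?D = "D_mat lam \<kappa> :: real ^ ('n + 'n) ^ ('n + 'n)"
  have P: "?P = block_mat a (- b) (- b) 0 \<eta> 0"
    using P_mat_eq_block[where C=C and \<mu>=\<mu> and \<rho>=\<rho> and \<kappa>=\<kappa> and \<eta>=\<eta> and 'n='n] assms(6) by (simp add: a_def b_def e_def h_def N_def)
  obtain R :: "real ^ ('n + 'n) ^ ('n + 'n)" where R: "R ** transpose R = block_mat s c g g h 0"
    using block_mat_square_root[of s h g c] pos cov(4) by (auto simp: N_def)
  interpret brownian_filtration M F W
    by (rule brownian_filtration.intro[OF assms(9) brownian_filtration_axioms.intro[OF assms(10,11)]])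
  have "?P ** (R ** transpose R) + (R ** transpose R) ** transpose ?P = ?D ** transpose ?D"
    unfolding P R
  proof (rule block_mat_lyapunov)
    show "a * s = lam" "\<eta> * h = \<kappa>"
      using pos assms(5) by (simp_all add: a_def s_def subst)
  qed (use assms cov in \<open>auto simp: N_def\<close>)
  moreover have "\<exists>v. v 0 = u \<and> (\<forall>s. (v has_vector_derivative - (transpose ?P *v v s)) (at s)) \<and> (v \<longlongrightarrow> 0) at_top" for u
    unfolding P using cov(1) pos assms(3,5) by (intro block_mat_adjoint_solution) (auto simp: N_def a_def)
  ultimately have "converges_in_distribution M Y (gaussian_law R) at_top"
    by (intro linear_sde_converges_in_distribution[OF assms(12)])
  then show ?thesis
    by (intro exI[of _ "gaussian_law R"])
       (auto simp: multivariate_normal_gaussian_law mean_gaussian_law covariance_gaussian_law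
         variance_gaussian_law[simplified mean_gaussian_law diff_0_right] R s_def c_def g_def K_def e_def h_def N_def)
qed

end
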